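(* Let $\gamma$ be a non-collision orbit of the regularized planar two-center problem lying on a regular torus $\mathbb{T}$ with rotation number $W$. Then its bi-infinite syzygy sequence is: $\dots121212\dots$ if $\mathbb{T}$ is of type P; $\dots 1\,3^{n_1}\,2\,3^{n_2}\,1\,3^{n_3}\,2\dots$ if $\mathbb{T}$ is of type L; $\dots 1\,3^{n_1}\,1\,3^{n_2}\,1\,3^{n_3}\,1\dots$ or $\dots 2\,3^{n_1}\,2\,3^{n_2}\,2\,3^{n_3}\,2\dots$ if $\mathbb{T}$ is of type S; where in the L and S cases $(n_i)_{i\in\mathbb{Z}}$ is the Sturmian sequence for rotation number $W$ and some intercept $y_0$. Conversely, in the L and S cases, for every intercept $y_0$ for which the line $y=Wx+y_0$ avoids $\mathbb{Z}^2$, the sequence of the corresponding form with $(n_i)$ the Sturmian sequence for $W$ and $y_0$ is realized by a non-collision orbit on $\mathbb{T}$.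
   Context: Fix $d>0$ and masses $m_1,m_2>0$ at the points $(-d,0)$ and $(d,0)$ of the plane. A test particle moves with Hamiltonian $H=\tfrac12(p_x^2+p_y^2)-m_1/\sqrt{(x+d)^2+y^2}-m_2/\sqrt{(x-d)^2+y^2}$; only energies $h<0$ are considered. Regularization: introduce $(\lambda,\nu)\in\mathbb{R}\times(\mathbb{R}/2\pi\mathbb{Z})$ by $x+iy=d\sin(\nu+i\lambda)$, i.e. $(x,y)=(d\cosh\lambda\sin\nu,\ d\sinh\lambda\cos\nu)$ (a double cover of the plane branched over the two centers, which correspond to $(\lambda,\nu)=(0,\pm\pi/2)$), with conjugate momenta $p_\lambda,p_\nu$, and the time change $dt=d^2(\cosh^2\lambda-\sin^2\nu)\,d\tau$. On the energy level $H=h$ the motion becomes (in time $\tau$) the flow of $H_\lambda(\lambda,p_\lambda)+H_\nu(\nu,p_\nu)$ on its zero level, where $H_\lambda=\tfrac12p_\lambda^2-d(m_1+m_2)\cosh\lambda-hd^2\cosh^2\lambda$ and $H_\nu=\tfrac12p_\nu^2+d(m_1-m_2)\sin\nu+hd^2\sin^2\nu$; each orbit lies in a set $\{H_\lambda=-g,\ H_\nu=g\}$, $g$ being a separation constant (the value of Euler's second integral). Regular torus: a compact connected component $\mathbb{T}=C_\lambda\times C_\nu$ of such a set, where $-g$ is a regular value of $H_\lambda$ and $g$ a regular value of $H_\nu$; $C_\lambda$ is a closed curve in the $(\lambda,p_\lambda)$-plane, $C_\nu$ a closed curve in the cylinder $(\mathbb{R}/2\pi\mathbb{Z})\times\mathbb{R}$.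 Every regular torus is of one of three types: S if $C_\nu$ is contractible in the cylinder; L if $C_\nu$ winds around the cylinder and $C_\lambda$ meets $\{\lambda=0\}$; P if $C_\nu$ winds around the cylinder and $C_\lambda$ does not meet $\{\lambda=0\}$. Rotation number: with $T_\lambda,T_\nu$ the $\tau$-periods of the motions on $C_\lambda$, $C_\nu$, $W=T_\nu/T_\lambda>0$. With angles $\theta_1\in\mathbb{R}/\mathbb{Z}$ along $C_\nu$, $\theta_2\in\mathbb{R}/\mathbb{Z}$ along $C_\lambda$, each increasing uniformly in $\tau$ with period 1, orbits on $\mathbb{T}$ lift to lines $\theta_2=W\theta_1+\mathrm{const}$. Syzygies: the particle is on the $x$-axis iff $\lambda=0$ or $\nu\equiv\pm\pi/2$. Symbol 3: $\lambda=0$, $\nu\not\equiv\pm\pi/2$ (strictly between the centers); symbol 1: $\nu\equiv-\pi/2$, $\lambda\neq0$ ($x<-d$); symbol 2: $\nu\equiv\pi/2$, $\lambda\neq0$ ($x>d$). Collision points: $\lambda=0$, $\nu\equiv\pm\pi/2$. A non-collision orbit is an orbit of the regularized flow on a regular torus containing no collision point; its syzygy sequence is the bi-infinite sequence of symbols recorded in time order. Sturmian sequence: for $m>0$ and $y_0$ with the line $y=mx+y_0$ avoiding $\mathbb{Z}^2$, put $y_k=y_0+km$ and, for $k\in\mathbb{Z}$, $n_k=\lfloor m\rfloor$ if $\{y_{k-1}\}+\{m\}<1$, $n_k=\lfloor m\rfloor+1$ if $\{y_{k-1}\}+\{m\}>1$ ($\lfloor\cdot\rfloor$ floor, $\{\cdot\}$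 fractional part). *)

theory Defs
  imports "HOL-Analysis.Analysis"
begin

text \<open>Planar two-center problem, regularized (Euler) coordinates.
  Parameters: d > 0, masses m1 m2 > 0, energy h < 0.\<close>

text \<open>Separated Hamiltonians; points of the (lambda, p_lambda)-plane and the lifted
  (nu, p_nu)-plane are pairs (coordinate, momentum).\<close>
definition Hlam :: "real \<Rightarrow> real \<Rightarrow> real \<Rightarrow> real \<Rightarrow> real \<times> real \<Rightarrow> real" where
  "Hlam d m1 m2 h z = (snd z)\<^sup>2 / 2 - d * (m1 + m2) * cosh (fst z) - h * d\<^sup>2 * (cosh (fst z))\<^sup>2"

definition Hnu :: "real \<Rightarrow> real \<Rightarrow> real \<Rightarrow> real \<Rightarrow> real \<times> real \<Rightarrow> real" where
  "Hnu d m1 m2 h z = (snd z)\<^sup>2 / 2 + d * (m1 - m2) * sin (fst z) + h * d\<^sup>2 * (sin (fst z))\<^sup>2"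

text \<open>The cylinder (R/2piZ) x R, realised as the embedded surface
  {(cos nu, sin nu, p)} in R^3; cylmap is the covering map from the lift.\<close>
definition cylmap :: "real \<times> real \<Rightarrow> real \<times> real \<times> real" where
  "cylmap z = (cos (fst z), sin (fst z), snd z)"

definition cylinder :: "(real \<times> real \<times> real) set" where
  "cylinder = range cylmap"

text \<open>c is a regular value of f: the derivative of f is nonzero at every point of f^-1(c).
  (For Hnu, which is 2pi-periodic in nu, this is the same as regularity on the cylinder.)\<close>
definition regular_value :: "(real \<times> real \<Rightarrow> real) \<Rightarrow> real \<Rightarrow> bool" where
  "regular_value f c \<longleftrightarrow>
     (\<forall>z. f z = c \<longrightarrow> (\<exists>D. (f has_derivative D) (at z) \<and> D \<noteq> (\<lambda>_. 0)))"

definition lam_level :: "real \<Rightarrow> real \<Rightarrow> real \<Rightarrow> real \<Rightarrow> real \<Rightarrow> (real \<times> real) set" where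
  "lam_level d m1 m2 h g = {z. Hlam d m1 m2 h z = - g}"

definition nu_level :: "real \<Rightarrow> real \<Rightarrow> real \<Rightarrow> real \<Rightarrow> real \<Rightarrow> (real \<times> real \<times> real) set" where
  "nu_level d m1 m2 h g = cylmap ` {z. Hnu d m1 m2 h z = g}"

text \<open>Regular torus T = Cl x Cv: a compact connected component of
  {H_lambda = -g} x {H_nu = g}, with -g, g regular values.  (Components of a product
  are exactly the products of components.)\<close>
definition regular_torus :: "real \<Rightarrow> real \<Rightarrow> real \<Rightarrow> real \<Rightarrow> real \<Rightarrow>
    (real \<times> real) set \<Rightarrow> (real \<times> real \<times> real) set \<Rightarrow> bool" where
  "regular_torus d m1 m2 h g Cl Cv \<longleftrightarrow>
     regular_value (Hlam d m1 m2 h) (- g) \<and> regular_value (Hnu d m1 m2 h) g \<and>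
     Cl \<in> components (lam_level d m1 m2 h g) \<and> Cv \<in> components (nu_level d m1 m2 h g) \<and>
     compact (Cl \<times> Cv)"

definition nu_contractible :: "(real \<times> real \<times> real) set \<Rightarrow> bool" where
  "nu_contractible Cv \<longleftrightarrow> (\<exists>c. homotopic_with_canon (\<lambda>_. True) Cv cylinder id (\<lambda>_. c))"

definition type_S :: "(real \<times> real) set \<Rightarrow> (real \<times> real \<times> real) set \<Rightarrow> bool" where
  "type_S Cl Cv \<longleftrightarrow> nu_contractible Cv"

definition type_L :: "(real \<times> real) set \<Rightarrow> (real \<times> real \<times> real) set \<Rightarrow> bool" where
  "type_L Cl Cv \<longleftrightarrow> \<not> nu_contractible Cv \<and> (\<exists>p. (0, p) \<in> Cl)"

definition type_P :: "(real \<times> real) set \<Rightarrow> (real \<times> real \<times> real) set \<Rightarrow> bool" where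
  "type_P Cl Cv \<longleftrightarrow> \<not> nu_contractible Cv \<and> \<not> (\<exists>p. (0, p) \<in> Cl)"

text \<open>Hamilton's equations (time tau) of H_lambda and of H_nu (nu lifted to R):
  lambda' = p_lambda, p_lambda' = - dH_lambda/dlambda, and likewise for nu.\<close>
definition lam_solution :: "real \<Rightarrow> real \<Rightarrow> real \<Rightarrow> real \<Rightarrow> (real \<Rightarrow> real) \<Rightarrow> (real \<Rightarrow> real) \<Rightarrow> bool" where
  "lam_solution d m1 m2 h l pl \<longleftrightarrow>
     (\<forall>t. (l has_real_derivative pl t) (at t) \<and>
          (pl has_real_derivative
             (d * (m1 + m2) * sinh (l t) + 2 * h * d\<^sup>2 * cosh (l t) * sinh (l t))) (at t))"

definition nu_solution :: "real \<Rightarrow> real \<Rightarrow> real \<Rightarrow> real \<Rightarrow> (real \<Rightarrow> real) \<Rightarrow> (real \<Rightarrow> real) \<Rightarrow> bool" where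
  "nu_solution d m1 m2 h v pv \<longleftrightarrow>
     (\<forall>t. (v has_real_derivative pv t) (at t) \<and>
          (pv has_real_derivative
             (- (d * (m1 - m2) * cos (v t) + 2 * h * d\<^sup>2 * sin (v t) * cos (v t)))) (at t))"

definition min_period :: "(real \<Rightarrow> 'a) \<Rightarrow> real \<Rightarrow> bool" where
  "min_period f T \<longleftrightarrow> T > 0 \<and> (\<forall>t. f (t + T) = f t) \<and>
     (\<forall>S. 0 < S \<and> S < T \<longrightarrow> \<not> (\<forall>t. f (t + S) = f t))"

definition lam_period :: "real \<Rightarrow> real \<Rightarrow> real \<Rightarrow> real \<Rightarrow> (real \<times> real) set \<Rightarrow> real \<Rightarrow> bool" where
  "lam_period d m1 m2 h Cl T \<longleftrightarrow>
     (\<forall>l pl. lam_solution d m1 m2 h l pl \<and> (l 0, pl 0) \<in> Cl \<longrightarrow>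
        min_period (\<lambda>t. (l t, pl t)) T)"

definition nu_period :: "real \<Rightarrow> real \<Rightarrow> real \<Rightarrow> real \<Rightarrow> (real \<times> real \<times> real) set \<Rightarrow> real \<Rightarrow> bool" where
  "nu_period d m1 m2 h Cv T \<longleftrightarrow>
     (\<forall>v pv. nu_solution d m1 m2 h v pv \<and> cylmap (v 0, pv 0) \<in> Cv \<longrightarrow>
        min_period (\<lambda>t. cylmap (v t, pv t)) T)"

definition rotation_number :: "real \<Rightarrow> real \<Rightarrow> real \<Rightarrow> real \<Rightarrow>
    (real \<times> real) set \<Rightarrow> (real \<times> real \<times> real) set \<Rightarrow> real \<Rightarrow> bool" where
  "rotation_number d m1 m2 h Cl Cv W \<longleftrightarrow>
     (\<exists>Tl Tv. lam_period d m1 m2 h Cl Tl \<and> nu_period d m1 m2 h Cv Tv \<and> W = Tv / Tl)"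

definition torus_orbit :: "real \<Rightarrow> real \<Rightarrow> real \<Rightarrow> real \<Rightarrow> (real \<times> real) set \<Rightarrow>
    (real \<times> real \<times> real) set \<Rightarrow> (real \<Rightarrow> real) \<Rightarrow> (real \<Rightarrow> real) \<Rightarrow> (real \<Rightarrow> real) \<Rightarrow> (real \<Rightarrow> real) \<Rightarrow> bool" where
  "torus_orbit d m1 m2 h Cl Cv l pl v pv \<longleftrightarrow>
     lam_solution d m1 m2 h l pl \<and> nu_solution d m1 m2 h v pv \<and>
     (\<forall>t. (l t, pl t) \<in> Cl \<and> cylmap (v t, pv t) \<in> Cv)"

text \<open>No collision point (lambda = 0, nu = +-pi/2 mod 2pi, i.e. cos nu = 0) on the orbit.\<close>
definition non_collision :: "(real \<Rightarrow> real) \<Rightarrow> (real \<Rightarrow> real) \<Rightarrow> bool" where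
  "non_collision l v \<longleftrightarrow> (\<forall>t. \<not> (l t = 0 \<and> cos (v t) = 0))"

text \<open>Syzygy times and their symbols: 3 if lambda = 0; 1 if nu = -pi/2 (sin nu = -1);
  2 if nu = pi/2 (sin nu = 1).\<close>
definition syzygy_times :: "(real \<Rightarrow> real) \<Rightarrow> (real \<Rightarrow> real) \<Rightarrow> real set" where
  "syzygy_times l v = {t. l t = 0 \<or> cos (v t) = 0}"

definition syzygy_symbol :: "(real \<Rightarrow> real) \<Rightarrow> (real \<Rightarrow> real) \<Rightarrow> real \<Rightarrow> nat" where
  "syzygy_symbol l v t = (if l t = 0 then 3 else if sin (v t) < 0 then 1 else 2)"

text \<open>s is the bi-infinite syzygy sequence of the orbit (up to shift of the index):
  the syzygy times are enumerated in increasing order by the integers.\<close>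
definition syzygy_seq :: "(real \<Rightarrow> real) \<Rightarrow> (real \<Rightarrow> real) \<Rightarrow> (int \<Rightarrow> nat) \<Rightarrow> bool" where
  "syzygy_seq l v s \<longleftrightarrow>
     (\<exists>tau :: int \<Rightarrow> real. strict_mono tau \<and> range tau = syzygy_times l v \<and>
        (\<forall>k. syzygy_symbol l v (tau k) = s k))"

definition line_avoids_lattice :: "real \<Rightarrow> real \<Rightarrow> bool" where
  "line_avoids_lattice m y0 \<longleftrightarrow> (\<forall>a b :: int. of_int b \<noteq> m * of_int a + y0)"

definition sturmian :: "real \<Rightarrow> real \<Rightarrow> int \<Rightarrow> int" where
  "sturmian m y0 k =
     (if frac (y0 + of_int (k - 1) * m) + frac m < 1 then \<lfloor>m\<rfloor> else \<lfloor>m\<rfloor> + 1)"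

text \<open>s has the block form ... b_0 3^(n_0) b_1 3^(n_1) b_2 ... : the positions of the
  non-3 symbols are enumerated increasingly by p, carry the letters b, and consecutive
  ones are separated by exactly n_i symbols 3.\<close>
definition block_form :: "(int \<Rightarrow> nat) \<Rightarrow> (int \<Rightarrow> int) \<Rightarrow> (int \<Rightarrow> nat) \<Rightarrow> bool" where
  "block_form b n s \<longleftrightarrow>
     (\<forall>k. s k \<in> {1, 2, 3}) \<and>
     (\<exists>p :: int \<Rightarrow> int. strict_mono p \<and> range p = {k. s k \<noteq> 3} \<and>
        (\<forall>i. s (p i) = b i \<and> p (i + 1) = p i + n i + 1))"

definition pattern_P :: "(int \<Rightarrow> nat) \<Rightarrow> bool" where
  "pattern_P s \<longleftrightarrow> (\<forall>k. s k \<in> {1, 2} \<and> s (k + 1) \<noteq> s k)"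

definition pattern_L :: "(int \<Rightarrow> int) \<Rightarrow> (int \<Rightarrow> nat) \<Rightarrow> bool" where
  "pattern_L n s \<longleftrightarrow> block_form (\<lambda>i. if odd i then 1 else 2) n s"

definition pattern_S :: "(int \<Rightarrow> int) \<Rightarrow> (int \<Rightarrow> nat) \<Rightarrow> bool" where
  "pattern_S n s \<longleftrightarrow> block_form (\<lambda>i. 1) n s \<or> block_form (\<lambda>i. 2) n s"

end

theory Submission
  imports Defs
begin

text \<open>
  On a regular torus the \<open>\<lambda>\<close>- and \<open>\<nu>\<close>-motions decouple into Newton equations whose forces are odd
  about \<open>\<lambda> = 0\<close> and about \<open>\<nu> = \<plusminus>\<pi>/2\<close>. Uniqueness of solutions turns these symmetries into
  equidistribution: the times with \<open>\<lambda> = 0\<close> form an arithmetic progression of step \<open>T\<^sub>\<lambda>/2\<close>, those with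
  \<open>\<nu> = \<plusminus>\<pi>/2\<close> one of step \<open>T\<^sub>\<nu>/2\<close>. On a rotating \<open>C\<^sub>\<nu>\<close> the sign alternates along the
  progression; on a contractible \<open>C\<^sub>\<nu>\<close> it is constant. Merging the two progressions gives a
  cutting sequence of slope \<open>W\<close>, and shifting the two motions independently in time realizes every
  intercept.

  The \<open>\<lambda>\<close>-potential is a convex quadratic in \<open>cosh \<lambda>\<close> and the \<open>\<nu>\<close>-potential a concave quadratic in
  \<open>sin \<nu>\<close>. Hence \<open>C\<^sub>\<nu>\<close> is contractible iff \<open>g\<close> lies below the maximum of the \<open>\<nu>\<close>-potential,
  oscillations in \<open>\<nu>\<close> are centred at \<open>\<plusminus>\<pi>/2\<close>, and \<open>g\<close> below that maximum forces the
  \<open>\<lambda>\<close>-motion through \<open>\<lambda> = 0\<close>.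
\<close>

section \<open>Global solutions of Lipschitz differential equations\<close>

lemma antiderivative_exists:
  fixes f :: "real \<Rightarrow> 'a::euclidean_space"
  assumes "continuous_on UNIV f"
  obtains G where "G 0 = 0" "\<And>t. (G has_vector_derivative f t) (at t)"
proof -
  define G where "G = (\<lambda>u::real. LBINT y=(0::real)..u. f y)"
  have "G 0 = 0" by (simp add: G_def)
  moreover have "(G has_vector_derivative f t) (at t)" for t
  proof -
    define M where "M = \<bar>t\<bar> + 1"
    have "(G has_vector_derivative f t) (at t within {-M..M})"
      unfolding G_def by (rule interval_integral_FTC2)
        (use assms in \<open>auto simp: M_def intro: continuous_on_subset\<close>)
    moreover have "t \<in> interior {-M..M}"
      by (auto simp: M_def)
    ultimately show ?thesis
      by (metis at_within_interior)
  qed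
  ultimately show thesis by (rule that)
qed

lemma norm_antiderivative_le_exp:
  fixes G :: "real \<Rightarrow> 'a::real_normed_vector"
  assumes "G 0 = 0" "\<And>s. (G has_vector_derivative g s) (at s)"
    and g: "\<And>s. norm (g s) \<le> C * exp (L * \<bar>s\<bar>)" and "L > 0"
  shows "norm (G t) \<le> C / L * exp (L * \<bar>t\<bar>)"
proof -
  have pos: "norm (H t) \<le> C / L * exp (L * t)"
    if "H 0 = 0" "\<And>s. (H has_vector_derivative k s) (at s)"
      "\<And>s. norm (k s) \<le> C * exp (L * \<bar>s\<bar>)" "t > 0"
    for H :: "real \<Rightarrow> 'a" and k t
  proof -
    have C: "C \<ge> 0"
      using order_trans[OF norm_ge_zero that(3)[of 0]] by simp
    have "norm (H t - H 0) \<le> C / L * exp (L * t) - C / L * exp (L * 0)"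
    proof (rule differentiable_bound_general[OF \<open>t > 0\<close>])
      show "continuous_on {0..t} H"
        using that(2) by (meson continuous_at_imp_continuous_on has_vector_derivative_continuous)
      show "continuous_on {0..t} (\<lambda>t. C / L * exp (L * t))"
        by (intro continuous_intros)
      show "(H has_vector_derivative k s) (at s)" for s by fact
      show "((\<lambda>t. C / L * exp (L * t)) has_vector_derivative C * exp (L * s)) (at s)" for s
        using \<open>L > 0\<close> unfolding has_real_derivative_iff_has_vector_derivative[symmetric]
        by (auto intro!: derivative_eq_intros)
      show "norm (k s) \<le> C * exp (L * s)" if "0 < s" for s
        using \<open>0 < s\<close> \<open>norm (k s) \<le> C * exp (L * \<bar>s\<bar>)\<close> by simp
    qed
    also have "\<dots> \<le> C / L * exp (L * t)" using C \<open>L > 0\<close> by simp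
    finally show ?thesis using that(1) by simp
  qed
  consider "t > 0" | "t = 0" | "t < 0" by linarith
  then show ?thesis
  proof cases
    case 1
    then show ?thesis using pos[of G g t] assms by simp
  next
    case 2
    have "C \<ge> 0"
      using order_trans[OF norm_ge_zero g[of 0]] by simp
    then show ?thesis using 2 assms by simp
  next
    case 3
    have "((\<lambda>s. G (- s)) has_vector_derivative - g (- s)) (at s)" for s
    proof -
      have "(uminus has_vector_derivative (-1::real)) (at s)"
        using has_vector_derivative_minus[OF has_vector_derivative_id] by simp
      from vector_diff_chain_at[OF this, of G "g (- s)"] assms(2) show ?thesis
        by (simp add: o_def)
    qed
    then have "norm (G (- (- t))) \<le> C / L * exp (L * (- t))"
      by (intro pos[where k = "\<lambda>s. - g (- s)"]) (use 3 assms in \<open>auto intro: order_trans[OF g]\<close>)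
    then show ?thesis using 3 by simp
  qed
qed

text \<open>Picard iteration is a contraction of the whole line at once for the norm
  \<open>sup\<^sub>t exp (- 2 K \<bar>t\<bar>) \<parallel>z t\<parallel>\<close>.\<close>

theorem lipschitz_ode_solution_exists:
  fixes f :: "'a::euclidean_space \<Rightarrow> 'a"
  assumes lip: "\<And>x y. norm (f x - f y) \<le> K * norm (x - y)" and "K > 0"
  obtains z where "z 0 = z0" "\<And>t::real. (z has_vector_derivative f (z t)) (at t)"
proof -
  define L where "L = 2 * K"
  have L: "L > 0" using \<open>K > 0\<close> by (simp add: L_def)
  define w where "w = (\<lambda>t::real. exp (L * \<bar>t\<bar>))"
  have w: "w t > 0" "w t \<ge> 1" for t using L by (auto simp: w_def)
  have contw: "continuous_on UNIV w" unfolding w_def by (intro continuous_intros)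
  have "K-lipschitz_on UNIV f"
    using lip \<open>K > 0\<close> by (auto intro!: lipschitz_onI simp: dist_norm)
  then have contf: "continuous_on UNIV f" by (rule lipschitz_on_continuous_on)
  define g where "g = (\<lambda>(u :: real \<Rightarrow>\<^sub>C 'a) s. f (w s *\<^sub>R u s))"
  have contg: "continuous_on UNIV (g u)" for u
    unfolding g_def
    by (intro continuous_on_compose2[OF contf] continuous_intros contw) auto
  have "\<exists>G. G 0 = 0 \<and> (\<forall>t. (G has_vector_derivative g u t) (at t))" for u
    using antiderivative_exists[OF contg] by metis
  then obtain I where I0: "\<And>u. I u 0 = 0"
    and I: "\<And>u t. (I u has_vector_derivative g u t) (at t)" by metis
  have contI: "continuous_on UNIV (I u)" for u
    using I by (meson continuous_at_imp_continuous_on has_vector_derivative_continuous)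
  have Ibound: "norm (I u t) \<le> (norm (f 0) + K * norm u) / L * w t" for u t
    unfolding w_def
  proof (rule norm_antiderivative_le_exp[OF I0 I _ L])
    fix s
    have "norm (g u s) \<le> norm (f 0) + norm (f (w s *\<^sub>R u s) - f 0)"
      unfolding g_def using norm_triangle_sub by blast
    also have "\<dots> \<le> norm (f 0) + K * norm (w s *\<^sub>R u s - 0)"
      by (intro add_left_mono lip)
    also have "\<dots> \<le> norm (f 0) * w s + K * (w s * norm u)"
      using w[of s] norm_bounded[of u s] \<open>K > 0\<close>
      by (intro add_mono mult_left_mono) (auto simp: mult_le_cancel_left1)
    finally show "norm (g u s) \<le> (norm (f 0) + K * norm u) * exp (L * \<bar>s\<bar>)"
      by (simp add: w_def algebra_simps)
  qed
  define P where "P = (\<lambda>u. Bcontfun (\<lambda>t. (1 / w t) *\<^sub>R (z0 + I u t)))"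
  have P: "P u t = (1 / w t) *\<^sub>R (z0 + I u t)" for u t
  proof -
    have "(\<lambda>t. (1 / w t) *\<^sub>R (z0 + I u t)) \<in> bcontfun"
    proof (rule bcontfun_normI)
      show "continuous_on UNIV (\<lambda>t. (1 / w t) *\<^sub>R (z0 + I u t))"
        using w(1) by (intro continuous_intros contw contI) (simp add: less_imp_neq[symmetric])
      fix t
      have "norm (z0 + I u t) \<le> norm z0 * w t + (norm (f 0) + K * norm u) / L * w t"
        by (rule order_trans[OF norm_triangle_ineq add_mono[OF _ Ibound]])
          (use w in \<open>auto simp: mult_le_cancel_left1\<close>)
      then show "norm ((1 / w t) *\<^sub>R (z0 + I u t)) \<le> norm z0 + (norm (f 0) + K * norm u) / L"
        using w(1)[of t] by (simp add: pos_divide_le_eq ring_distribs del: scaleR_add_right)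
    qed
    then show ?thesis unfolding P_def by (simp add: Bcontfun_inverse)
  qed
  have "dist (P u) (P v) \<le> 1 / 2 * dist u v" for u v
  proof (rule dist_bound)
    fix t
    have "norm (I u t - I v t) \<le> (K * dist u v) / L * w t"
      unfolding w_def
    proof (rule norm_antiderivative_le_exp[of "\<lambda>t. I u t - I v t" "\<lambda>t. g u t - g v t", OF _ _ _ L])
      show "((\<lambda>t. I u t - I v t) has_vector_derivative g u s - g v s) (at s)" for s
        by (intro has_vector_derivative_diff I)
      fix s
      have "norm (g u s - g v s) \<le> K * norm (w s *\<^sub>R u s - w s *\<^sub>R v s)"
        unfolding g_def by (rule lip)
      also have "\<dots> = K * (w s * dist (u s) (v s))"
        using w(1)[of s] by (simp add: dist_norm flip: scaleR_diff_right)
      also have "\<dots> \<le> K * (w s * dist u v)"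
        using w(1)[of s] \<open>K > 0\<close> by (intro mult_left_mono dist_bounded) auto
      finally show "norm (g u s - g v s) \<le> K * dist u v * exp (L * \<bar>s\<bar>)"
        by (simp add: w_def algebra_simps)
    qed (simp add: I0)
    then have "norm (I u t - I v t) / w t \<le> 1 / 2 * dist u v"
      using w(1)[of t] \<open>K > 0\<close> by (simp add: L_def field_simps)
    then show "dist (P u t) (P v t) \<le> 1 / 2 * dist u v"
      using w(1)[of t] by (simp add: P dist_norm flip: scaleR_diff_right)
  qed
  then obtain u where u: "P u = u"
    using banach_fix_type[of "1 / 2" P] by auto
  have z: "w t *\<^sub>R u t = z0 + I u t" for t
    using P[of u t] w(1)[of t] unfolding u by simp
  show thesis
  proof
    show "z0 + I u 0 = z0" by (simp add: I0)
    show "((\<lambda>t. z0 + I u t) has_vector_derivative f (z0 + I u t)) (at t)" for t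
      using has_vector_derivative_add[OF has_vector_derivative_const I, of z0 u t]
      by (simp add: g_def z)
  qed
qed

section \<open>Newton equations on the line\<close>

definition newton_solution :: "(real \<Rightarrow> real) \<Rightarrow> (real \<Rightarrow> real) \<Rightarrow> (real \<Rightarrow> real) \<Rightarrow> bool" where
  "newton_solution F x p \<longleftrightarrow>
     (\<forall>t. (x has_real_derivative p t) (at t) \<and> (p has_real_derivative F (x t)) (at t))"

lemma newton_solutionD:
  assumes "newton_solution F x p"
  shows "(x has_real_derivative p t) (at t)" "(p has_real_derivative F (x t)) (at t)"
    "isCont x t" "isCont p t" "continuous_on A x" "continuous_on A p"
  using assms unfolding newton_solution_def
  by (auto intro: DERIV_isCont continuous_at_imp_continuous_on)

lemma newton_solution_exists:
  assumes lip: "\<And>x y. \<bar>F x - F y\<bar> \<le> K * \<bar>x - y\<bar>" and "K \<ge> 0"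
  obtains x p where "newton_solution F x p" "x 0 = x0" "p 0 = p0"
proof -
  define f where "f = (\<lambda>z::real \<times> real. (snd z, F (fst z)))"
  have lipf: "norm (f y - f z) \<le> (1 + K) * norm (y - z)" for y z
  proof -
    have "norm (f y - f z) \<le> \<bar>snd (y - z)\<bar> + \<bar>F (fst y) - F (fst z)\<bar>"
      unfolding f_def using norm_Pair_le[of "snd y - snd z" "F (fst y) - F (fst z)"] by simp
    also have "\<dots> \<le> norm (y - z) + K * norm (y - z)"
    proof (rule add_mono)
      show "\<bar>snd (y - z)\<bar> \<le> norm (y - z)"
        using norm_snd_le[of "snd (y - z)" "fst (y - z)"] unfolding prod.collapse real_norm_def .
      have "\<bar>fst y - fst z\<bar> \<le> norm (y - z)"
        using norm_fst_le[of "fst (y - z)" "snd (y - z)"] unfolding prod.collapse real_norm_def by simp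
      then show "\<bar>F (fst y) - F (fst z)\<bar> \<le> K * norm (y - z)"
        using \<open>K \<ge> 0\<close> by (intro order_trans[OF lip] mult_left_mono) auto
    qed
    finally show ?thesis by (simp add: algebra_simps)
  qed
  have "1 + K > 0" using \<open>K \<ge> 0\<close> by simp
  then obtain z where z: "z 0 = (x0, p0)" "\<And>t. (z has_vector_derivative f (z t)) (at t)"
    by (rule lipschitz_ode_solution_exists[OF lipf]) blast
  have "newton_solution F (fst \<circ> z) (snd \<circ> z)"
    unfolding newton_solution_def has_real_derivative_iff_has_vector_derivative
  proof (intro allI conjI)
    fix t
    show "(fst \<circ> z has_vector_derivative (snd \<circ> z) t) (at t)"
      using bounded_linear.has_vector_derivative[OF bounded_linear_fst z(2), of t]
      by (simp add: f_def o_def)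
    show "(snd \<circ> z has_vector_derivative F ((fst \<circ> z) t)) (at t)"
      using bounded_linear.has_vector_derivative[OF bounded_linear_snd z(2), of t]
      by (simp add: f_def o_def)
  qed
  then show thesis by (rule that) (simp_all add: z(1))
qed

lemma newton_solution_time_shift:
  assumes "newton_solution F x p"
  shows "newton_solution F (\<lambda>t. x (t + c)) (\<lambda>t. p (t + c))"
  using assms unfolding newton_solution_def DERIV_shift[symmetric] by blast

lemma newton_solution_time_reversal:
  assumes "newton_solution F x p"
  shows "newton_solution F (\<lambda>t. x (c - t)) (\<lambda>t. - p (c - t))"
proof -
  have "((\<lambda>t. x (c - t)) has_real_derivative - p (c - t)) (at t)"
    "((\<lambda>t. - p (c - t)) has_real_derivative F (x (c - t))) (at t)" for t
  proof -
    have r: "((\<lambda>t. c - t) has_real_derivative - 1) (at t)"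
      by (auto intro!: derivative_eq_intros)
    from DERIV_chain2[OF newton_solutionD(1)[OF assms] r]
    show "((\<lambda>t. x (c - t)) has_real_derivative - p (c - t)) (at t)" by simp
    from DERIV_minus[OF DERIV_chain2[OF newton_solutionD(2)[OF assms] r]]
    show "((\<lambda>t. - p (c - t)) has_real_derivative F (x (c - t))) (at t)" by simp
  qed
  then show ?thesis unfolding newton_solution_def by blast
qed

lemma newton_solution_reflection:
  assumes "newton_solution F x p" "\<And>y. F (2 * c - y) = - F y"
  shows "newton_solution F (\<lambda>t. 2 * c - x t) (\<lambda>t. - p t)"
proof -
  have "((\<lambda>t. 2 * c - x t) has_real_derivative - p t) (at t)"
    "((\<lambda>t. - p t) has_real_derivative F (2 * c - x t)) (at t)" for t
    using DERIV_diff[OF DERIV_const newton_solutionD(1)[OF assms(1)], of "2 * c" t]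
      DERIV_minus[OF newton_solutionD(2)[OF assms(1)], of t] by (simp_all add: assms(2))
  then show ?thesis unfolding newton_solution_def by blast
qed

lemma newton_solution_translation:
  assumes "newton_solution F x p" "\<And>y. F (y + c) = F y"
  shows "newton_solution F (\<lambda>t. x t + c) p"
proof -
  have "((\<lambda>t. x t + c) has_real_derivative p t) (at t)" for t
    by (rule DERIV_cong[OF DERIV_add[OF newton_solutionD(1)[OF assms(1)] DERIV_const]]) simp
  then show ?thesis using assms unfolding newton_solution_def by simp
qed

lemma newton_solution_energy:
  assumes "newton_solution F x p" "\<And>y. (U has_real_derivative - F y) (at y)"
  shows "(p t)\<^sup>2 / 2 + U (x t) = (p s)\<^sup>2 / 2 + U (x s)"
proof -
  have "((\<lambda>t. (p t)\<^sup>2 / 2 + U (x t)) has_real_derivative 0) (at t)" for t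
    by (rule DERIV_cong[OF DERIV_add[OF
        DERIV_cdivide[OF DERIV_power[OF newton_solutionD(2)[OF assms(1)], of 2]]
        DERIV_chain2[OF assms(2) newton_solutionD(1)[OF assms(1)]]]]) simp
  then show ?thesis by (rule DERIV_isconst_all[rule_format])
qed

definition locally_lipschitz_real :: "(real \<Rightarrow> real) \<Rightarrow> bool" where
  "locally_lipschitz_real F \<longleftrightarrow>
     (\<forall>R. \<exists>K. \<forall>x\<in>{-R..R}. \<forall>y\<in>{-R..R}. \<bar>F x - F y\<bar> \<le> K * \<bar>x - y\<bar>)"

lemma locally_lipschitz_realI:
  assumes "\<And>x. (F has_real_derivative F' x) (at x)" "continuous_on UNIV F'"
  shows "locally_lipschitz_real F"
  unfolding locally_lipschitz_real_def
proof
  fix R :: real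
  have "compact (F' ` {-R..R})"
    by (intro compact_continuous_image continuous_on_subset[OF assms(2)]) auto
  then obtain K where K: "\<forall>x\<in>{-R..R}. norm (F' x) \<le> K"
    using compact_imp_bounded bounded_iff[of "F' ` {-R..R}"] by blast
  have "norm (F x - F y) \<le> K * norm (x - y)" if "x \<in> {-R..R}" "y \<in> {-R..R}" for x y
    by (rule field_differentiable_bound[of "{-R..R}" F F'])
      (use that K assms(1) in \<open>auto intro: has_field_derivative_at_within\<close>)
  then show "\<exists>K. \<forall>x\<in>{-R..R}. \<forall>y\<in>{-R..R}. \<bar>F x - F y\<bar> \<le> K * \<bar>x - y\<bar>"
    unfolding real_norm_def by blast
qed

lemma newton_solution_unique_forward:
  assumes x: "newton_solution F x p" and y: "newton_solution F y q"
    and F: "locally_lipschitz_real F"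
    and init: "x a = y a" "p a = q a" and "a \<le> b"
  shows "x b = y b \<and> p b = q b"
proof -
  have "compact (x ` {a..b} \<union> y ` {a..b})"
    by (intro compact_Un compact_continuous_image newton_solutionD[OF x] newton_solutionD[OF y]) auto
  then obtain R where "\<forall>u\<in>x ` {a..b} \<union> y ` {a..b}. norm u \<le> R"
    using compact_imp_bounded bounded_iff by blast
  then have R: "x t \<in> {-R..R} \<and> y t \<in> {-R..R}" if "t \<in> {a..b}" for t
  proof -
    have "norm (x t) \<le> R" "norm (y t) \<le> R" using \<open>\<forall>u\<in>_. _\<close> that by blast+
    then show ?thesis by auto
  qed
  obtain K0 where K0: "\<forall>u\<in>{-R..R}. \<forall>w\<in>{-R..R}. \<bar>F u - F w\<bar> \<le> K0 * \<bar>u - w\<bar>"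
    using F unfolding locally_lipschitz_real_def by blast
  define K where "K = \<bar>K0\<bar>"
  have K: "\<bar>F (x t) - F (y t)\<bar> \<le> K * \<bar>x t - y t\<bar>" if "t \<in> {a..b}" for t
  proof -
    have "\<bar>F (x t) - F (y t)\<bar> \<le> K0 * \<bar>x t - y t\<bar>"
      using K0 R[OF that] by blast
    also have "\<dots> \<le> K * \<bar>x t - y t\<bar>"
      unfolding K_def by (intro mult_right_mono) auto
    finally show ?thesis .
  qed
  define e where "e = (\<lambda>t. ((x t - y t)\<^sup>2 + (p t - q t)\<^sup>2) * exp (- (1 + K) * t))"
  define e' where "e' = (\<lambda>t. (2 * (x t - y t) * (p t - q t) + 2 * (p t - q t) * (F (x t) - F (y t))
    - (1 + K) * ((x t - y t)\<^sup>2 + (p t - q t)\<^sup>2)) * exp (- (1 + K) * t))"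
  have deriv: "(e has_real_derivative e' t) (at t)" for t
    unfolding e_def e'_def
  proof -
    have "((\<lambda>t. exp (- (1 + K) * t)) has_real_derivative - (1 + K) * exp (- (1 + K) * t)) (at t)"
      by (auto intro!: derivative_eq_intros)
    from DERIV_mult[OF DERIV_add[OF
        DERIV_power[OF DERIV_diff[OF newton_solutionD(1)[OF x] newton_solutionD(1)[OF y]], of 2]
        DERIV_power[OF DERIV_diff[OF newton_solutionD(2)[OF x] newton_solutionD(2)[OF y]], of 2]] this]
    show "((\<lambda>t. ((x t - y t)\<^sup>2 + (p t - q t)\<^sup>2) * exp (- (1 + K) * t)) has_real_derivative
      (2 * (x t - y t) * (p t - q t) + 2 * (p t - q t) * (F (x t) - F (y t))
        - (1 + K) * ((x t - y t)\<^sup>2 + (p t - q t)\<^sup>2)) * exp (- (1 + K) * t)) (at t)"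
      by (rule DERIV_cong) (simp add: algebra_simps)
  qed
  have nonpos: "e' t \<le> 0" if "t \<in> {a..b}" for t
  proof -
    define X P where "X = \<bar>x t - y t\<bar>" and "P = \<bar>p t - q t\<bar>"
    have "2 * (x t - y t) * (p t - q t) \<le> 2 * (X * P)"
      unfolding X_def P_def mult.assoc abs_mult[symmetric] by (intro mult_left_mono) auto
    moreover have "(p t - q t) * (F (x t) - F (y t)) \<le> P * (K * X)"
    proof -
      have "(p t - q t) * (F (x t) - F (y t)) \<le> P * \<bar>F (x t) - F (y t)\<bar>"
        unfolding P_def abs_mult[symmetric] by (rule abs_ge_self)
      also have "\<dots> \<le> P * (K * X)"
        unfolding X_def P_def using K[OF that] by (rule mult_left_mono) simp
      finally show ?thesis .
    qed
    moreover have "2 * (X * P) \<le> X\<^sup>2 + P\<^sup>2"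
      using zero_le_power2[of "X - P"] by (simp add: power2_diff)
    moreover from this have "K * (2 * (X * P)) \<le> K * (X\<^sup>2 + P\<^sup>2)"
      by (intro mult_left_mono) (auto simp: K_def)
    moreover have "X\<^sup>2 = (x t - y t)\<^sup>2" "P\<^sup>2 = (p t - q t)\<^sup>2"
      by (auto simp: X_def P_def)
    ultimately have "2 * (x t - y t) * (p t - q t) + 2 * (p t - q t) * (F (x t) - F (y t))
      - (1 + K) * ((x t - y t)\<^sup>2 + (p t - q t)\<^sup>2) \<le> 0"
      by (simp add: algebra_simps)
    then show ?thesis unfolding e'_def by (simp add: mult_nonpos_nonneg)
  qed
  have "e b \<le> e a"
    by (rule DERIV_nonpos_imp_nonincreasing[OF \<open>a \<le> b\<close>], intro exI conjI, rule deriv, rule nonpos) simp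
  also have "e a = 0" by (simp add: e_def init)
  finally have "(x b - y b)\<^sup>2 + (p b - q b)\<^sup>2 \<le> 0"
    unfolding e_def by (simp add: mult_le_0_iff not_le)
  then show ?thesis by (simp add: sum_power2_le_zero_iff)
qed

lemma newton_solution_unique:
  assumes x: "newton_solution F x p" and y: "newton_solution F y q"
    and F: "locally_lipschitz_real F" and init: "x a = y a" "p a = q a"
  shows "x t = y t" "p t = q t"
proof -
  have "x t = y t \<and> p t = q t"
  proof (cases "a \<le> t")
    case True
    then show ?thesis using newton_solution_unique_forward[OF x y F init] by blast
  next
    case False
    then show ?thesis
      using newton_solution_unique_forward[OF newton_solution_time_reversal[OF x, of 0]
          newton_solution_time_reversal[OF y, of 0] F, of "- a" "- t"] init by simp
  qed
  then show "x t = y t" "p t = q t" by auto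
qed


lemma periodic_int:
  fixes f :: "real \<Rightarrow> 'a"
  assumes "\<And>t. f (t + T) = f t"
  shows "f (t + of_int k * T) = f t"
proof -
  have nat: "f (t + of_nat n * T) = f t" for n t
  proof (induction n)
    case (Suc n)
    have "f (t + of_nat (Suc n) * T) = f ((t + of_nat n * T) + T)" by (simp add: algebra_simps)
    then show ?case using assms Suc by simp
  qed simp
  show ?thesis
  proof (cases "k \<ge> 0")
    case True
    then show ?thesis using nat[of t "nat k"] by simp
  next
    case False
    then show ?thesis using nat[of "t + of_int k * T" "nat (- k)"] by simp
  qed
qed

lemma min_period_imp_multiple:
  assumes "min_period f T" "\<And>t. f (t + S) = f t"
  obtains k :: int where "S = of_int k * T"
proof -
  have T: "T > 0" "\<And>t. f (t + T) = f t" using assms(1) by (auto simp: min_period_def)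
  define k where "k = \<lfloor>S / T\<rfloor>"
  define r where "r = S - of_int k * T"
  have "of_int k \<le> S / T" "S / T < of_int k + 1" unfolding k_def by linarith+
  then have r: "r \<ge> 0" "r < T"
    using T(1) by (auto simp: r_def field_simps)
  have "f (t + r) = f t" for t
  proof -
    have "f (t + r) = f ((t + r) + of_int k * T)"
      using periodic_int[of f T, OF T(2)] by metis
    also have "\<dots> = f (t + S)" by (simp add: r_def)
    finally show ?thesis using assms(2) by simp
  qed
  with r assms(1) have "r = 0" unfolding min_period_def by (metis less_eq_real_def)
  then show thesis using that[of k] by (simp add: r_def)
qed

lemma periodic_newton_solution_extrema:
  assumes sol: "newton_solution F x p" and T: "T > 0" "\<And>t. x (t + T) = x t"
  obtains a b where "\<And>t. x a \<le> x t" "\<And>t. x t \<le> x b" "p a = 0" "p b = 0"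
proof -
  have red: "\<exists>s\<in>{0..T}. x t = x s" for t
  proof
    define k where "k = \<lfloor>t / T\<rfloor>"
    have "of_int k \<le> t / T" "t / T < of_int k + 1" unfolding k_def by linarith+
    then show "t + of_int (- k) * T \<in> {0..T}"
      using T(1) by (auto simp: field_simps)
    show "x t = x (t + of_int (- k) * T)"
      using periodic_int[of x T, OF T(2)] by metis
  qed
  have cont: "continuous_on {0..T} x" by (rule newton_solutionD[OF sol])
  obtain a where a: "\<forall>s\<in>{0..T}. x a \<le> x s"
    using continuous_attains_inf[OF _ _ cont] T(1) by fastforce
  obtain b where b: "\<forall>s\<in>{0..T}. x s \<le> x b"
    using continuous_attains_sup[OF _ _ cont] T(1) by fastforce
  show thesis
  proof
    show a': "x a \<le> x t" for t using red[of t] a by force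
    show b': "x t \<le> x b" for t using red[of t] b by force
    show "p a = 0"
      by (rule DERIV_local_min[OF newton_solutionD(1)[OF sol] zero_less_one]) (use a' in auto)
    show "p b = 0"
      by (rule DERIV_local_max[OF newton_solutionD(1)[OF sol] zero_less_one]) (use b' in auto)
  qed
qed

lemma newton_solution_point_symmetry:
  assumes sol: "newton_solution F x p" and lip: "locally_lipschitz_real F"
    and odd: "\<And>y. F (2 * c - y) = - F y" and "x a = c"
  shows "x (a + s) = 2 * c - x (a - s)"
proof -
  have "newton_solution F (\<lambda>t. 2 * c - x (2 * a - t)) (\<lambda>t. - (- p (2 * a - t)))"
    by (rule newton_solution_reflection[OF newton_solution_time_reversal[OF sol] odd])
  from newton_solution_unique(1)[OF sol this lip, of a "a + s"] \<open>x a = c\<close>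
  show ?thesis by (simp add: algebra_simps)
qed

lemma oscillation_center_times:
  assumes sol: "newton_solution F x p" and lip: "locally_lipschitz_real F"
    and odd: "\<And>y. F (2 * c - y) = - F y"
    and U: "\<And>y. (U has_real_derivative - F y) (at y)"
    and per: "min_period (\<lambda>t. (x t, p t)) T" and a: "x a = c"
  shows "{t. x t = c} = range (\<lambda>k::int. a + of_int k * (T / 2))"
proof (intro equalityI subsetI)
  have T: "T > 0" "\<And>t. x (t + T) = x t" using per by (auto simp: min_period_def)
  fix t assume "t \<in> range (\<lambda>k::int. a + of_int k * (T / 2))"
  then obtain k :: int where k: "t = a + of_int k * (T / 2)" by blast
  have "x t = 2 * c - x (a - of_int k * (T / 2))"
    unfolding k by (rule newton_solution_point_symmetry[OF sol lip odd a])
  also have "x (a - of_int k * (T / 2)) = x (a - of_int k * (T / 2) + of_int k * T)"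
    using periodic_int[of x T, OF T(2)] by metis
  also have "\<dots> = x t" by (simp add: k field_simps)
  finally show "t \<in> {t. x t = c}" by simp
next
  fix b assume "b \<in> {t. x t = c}"
  then have b: "x b = c" by simp
  define S where "S = b - a"
  have shift: "newton_solution F (\<lambda>t. x (t + S)) (\<lambda>t. p (t + S))"
    by (rule newton_solution_time_shift[OF sol])
  have "\<exists>k::int. 2 * S = of_int k * T"
  proof -
    have "(p a)\<^sup>2 = (p b)\<^sup>2" using newton_solution_energy[OF sol U, of a b] a b by simp
    then consider "p b = p a" | "p b = - p a" by (auto simp: power2_eq_iff)
    then have "\<And>t. (x (t + 2 * S), p (t + 2 * S)) = (x t, p t)"
    proof cases
      case 1
      have "x (t + S) = x t" "p (t + S) = p t" for t
        using newton_solution_unique[OF shift sol lip, of a] a b 1 by (auto simp: S_def)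
      from this[of "t + S" for t] this show "\<And>t. (x (t + 2 * S), p (t + 2 * S)) = (x t, p t)"
        by (simp add: algebra_simps)
    next
      case 2
      have "x (t + S) = 2 * c - x t" "p (t + S) = - p t" for t
        using newton_solution_unique[OF shift newton_solution_reflection[OF sol odd] lip, of a]
          a b 2 by (auto simp: S_def)
      from this[of "t + S" for t] this show "\<And>t. (x (t + 2 * S), p (t + 2 * S)) = (x t, p t)"
        by (simp add: algebra_simps)
    qed
    then show ?thesis using min_period_imp_multiple[OF per] by blast
  qed
  then obtain k :: int where "2 * S = of_int k * T" by blast
  then have "b = a + of_int k * (T / 2)" by (simp add: S_def)
  then show "b \<in> range (\<lambda>k::int. a + of_int k * (T / 2))" by blast
qed

lemma rotation_half_turn_times:
  assumes sol: "newton_solution F x p" and lip: "locally_lipschitz_real F"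
    and odd: "\<And>y. F (2 * c - y) = - F y" and perF: "\<And>y. F (y + 2 * pi) = F y"
    and U: "\<And>y. (U has_real_derivative - F y) (at y)" and perU: "\<And>y. U (y + 2 * pi) = U y"
    and per: "min_period (\<lambda>t. cylmap (x t, p t)) T"
    and e: "e = 1 \<or> e = (-1::real)" and "\<delta> > 0" and speed: "\<And>t. e * p t \<ge> \<delta>"
  obtains b where "\<And>k::int. x (b + of_int k * (T / 2)) = c + e * of_int k * pi"
    "\<And>t (j::int). x t = c + of_int j * pi \<Longrightarrow> \<exists>k::int. t = b + of_int k * (T / 2)"
proof -
  have mono: "e * x s + \<delta> * (t - s) \<le> e * x t" if "s \<le> t" for s t
  proof -
    have "((\<lambda>t. e * x t - \<delta> * t) has_real_derivative e * p t - \<delta>) (at t)" for t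
      by (rule DERIV_cong[OF DERIV_diff[OF DERIV_cmult[OF newton_solutionD(1)[OF sol]]
            DERIV_cmult[OF DERIV_ident]]]) simp
    then have "e * x s - \<delta> * s \<le> e * x t - \<delta> * t"
      by (rule DERIV_nonneg_imp_nondecreasing[OF that, OF exI, OF conjI]) (use speed in auto)
    then show ?thesis by (simp add: algebra_simps)
  qed
  have strict: "e * x s < e * x t" if "s < t" for s t
    using mono[of s t] that mult_pos_pos[OF \<open>\<delta> > 0\<close>, of "t - s"] by linarith
  have surj: "\<exists>t. x t = y" for y
  proof -
    define N where "N = \<bar>e * y - e * x 0\<bar> / \<delta>"
    have N: "N \<ge> 0" "\<delta> * N = \<bar>e * y - e * x 0\<bar>"
      using \<open>\<delta> > 0\<close> by (auto simp: N_def)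
    have "\<exists>t. - N \<le> t \<and> t \<le> N \<and> e * x t = e * y"
    proof (rule IVT')
      show "e * x (- N) \<le> e * y" using mono[of "- N" 0] N by (auto simp: algebra_simps)
      show "e * y \<le> e * x N" using mono[of 0 N] N by (auto simp: algebra_simps)
      show "continuous_on {- N..N} (\<lambda>t. e * x t)"
        by (intro continuous_intros newton_solutionD[OF sol])
    qed (use N in auto)
    then show ?thesis using e by auto
  qed
  have inj: "s = t" if "x s = x t" for s t
    using strict[of s t] strict[of t s] that by (metis linorder_neqE_linordered_idom less_irrefl)
  have ee: "e * e = 1" using e by auto
  have perF': "F (y + 2 * pi * e) = F y" for y
    using e perF[of y] perF[of "y - 2 * pi"] by auto
  have perU': "U (y + 2 * pi * e) = U y" for y
    using e perU[of y] perU[of "y - 2 * pi"] by auto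
  obtain b where b: "x b = c" using surj by blast
  obtain b' where b': "x b' = c + 2 * pi * e" using surj by blast
  define S where "S = b' - b"
  have "S > 0"
  proof (rule ccontr)
    assume "\<not> S > 0"
    then have "e * x b' \<le> e * x b" using strict[of b' b] by (cases "b = b'") (auto simp: S_def)
    then show False using ee pi_gt_zero by (simp add: b b' algebra_simps)
  qed
  have "(p b')\<^sup>2 = (p b)\<^sup>2"
    using newton_solution_energy[OF sol U, of b b'] perU' by (simp add: b b')
  moreover have "e * p b > 0" "e * p b' > 0"
    using speed \<open>\<delta> > 0\<close> by (meson less_le_trans)+
  ultimately have pb: "p b' = p b"
    using e by (auto simp: power2_eq_iff)
  have S: "x (t + S) = x t + 2 * pi * e" "p (t + S) = p t" for t
    using newton_solution_unique[OF newton_solution_time_shift[OF sol, of S]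
        newton_solution_translation[OF sol perF'] lip, of b] pb
    by (auto simp: S_def b b')
  have T: "T > 0" "\<And>t. cylmap (x (t + T), p (t + T)) = cylmap (x t, p t)"
    using per by (auto simp: min_period_def)
  have "cylmap (x (t + S), p (t + S)) = cylmap (x t, p t)" for t
    unfolding S cylmap_def using e by (auto simp: cos_diff sin_diff)
  then obtain k :: int where k: "S = of_int k * T"
    by (rule min_period_imp_multiple[OF per])
  with \<open>S > 0\<close> T(1) have "k \<ge> 1" by (simp add: zero_less_mult_iff)
  then have "T \<le> S" using T(1) unfolding k by simp
  moreover have "S \<le> T"
  proof (rule ccontr)
    assume "\<not> S \<le> T"
    have "sin (x (b + T)) = sin c \<and> cos (x (b + T)) = cos c"
      using T(2)[of b] by (simp add: cylmap_def b)
    then obtain n :: int where n: "x (b + T) = c + 2 * pi * n"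
      using sin_cos_eq_iff by blast
    have "e * x b < e * x (b + T)" "e * x (b + T) < e * x (b + S)"
      using strict T(1) \<open>\<not> S \<le> T\<close> by auto
    then have "0 < (2 * pi) * (e * n)" "(2 * pi) * (e * n) < (2 * pi) * (e * e)"
      unfolding n S(1) b by (simp_all add: algebra_simps)
    then have "0 < e * n" "e * n < 1" unfolding ee
      by (auto simp: zero_less_mult_iff)
    then show False using e by auto
  qed
  ultimately have ST: "S = T" by simp
  have xk: "x (t + of_int k * T) = x t + 2 * pi * e * of_int k" for t k
  proof -
    define w where "w = 2 * pi * e / T"
    have w: "w * T = 2 * pi * e" using T(1) by (simp add: w_def)
    have "x (t + of_int k * T) - w * (t + of_int k * T) = x t - w * t"
      by (rule periodic_int[of "\<lambda>t. x t - w * t"]) (simp add: S(1)[unfolded ST] w distrib_left)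
    moreover have "w * (t + of_int k * T) = w * t + of_int k * (w * T)" by (simp add: algebra_simps)
    ultimately show ?thesis unfolding w by (simp add: algebra_simps)
  qed
  have half: "x (b + of_int k * (T / 2)) = c + e * of_int k * pi" for k
  proof -
    have "x (b + of_int k * (T / 2)) = 2 * c - x (b - of_int k * (T / 2))"
      by (rule newton_solution_point_symmetry[OF sol lip odd b])
    moreover have "x (b + of_int k * (T / 2)) = x (b - of_int k * (T / 2)) + 2 * pi * e * of_int k"
      using xk[of "b - of_int k * (T / 2)" k] by (simp add: field_simps)
    ultimately show ?thesis by simp
  qed
  show thesis
  proof
    show "x (b + of_int k * (T / 2)) = c + e * of_int k * pi" for k by fact
    fix t and j :: int assume "x t = c + of_int j * pi"
    moreover obtain i :: int where "e * of_int i = (of_int j :: real)"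
      using e by (metis mult_1 mult_minus1 of_int_minus minus_minus)
    ultimately have "x t = x (b + of_int i * (T / 2))" unfolding half by simp
    then show "\<exists>k::int. t = b + of_int k * (T / 2)" using inj by blast
  qed
qed

section \<open>Merging two arithmetic progressions\<close>

lemma sturmian_eq_floor_diff:
  "sturmian W y0 i = \<lfloor>y0 + of_int i * W\<rfloor> - \<lfloor>y0 + of_int (i - 1) * W\<rfloor>"
proof -
  have "y0 + of_int i * W = (y0 + of_int (i - 1) * W) + W" by (simp add: algebra_simps)
  then show ?thesis unfolding sturmian_def by (simp only: floor_add) simp
qed

lemma strict_mono_int_stepI:
  fixes f :: "int \<Rightarrow> 'a::order"
  assumes "\<And>k. f k < f (k + 1)"
  shows "strict_mono f"
proof (rule strict_monoI)
  fix i j :: int assume "i < j"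
  then show "f i < f j"
    by (induction rule: int_gr_induct) (use assms less_trans in blast)+
qed

text \<open>In the merged sequence the \<open>i\<close>-th point of the progression sits at position
  \<open>i + \<lfloor>y0 + (i - 1) W\<rfloor>\<close>: it is preceded by \<open>i\<close> points of the progression and by
  \<open>\<lfloor>y0 + (i - 1) W\<rfloor>\<close> integers, both counted from a common origin.\<close>

lemma merge_integers_with_progression:
  assumes "W > 0" and avoid: "line_avoids_lattice W y0"
  obtains \<tau> :: "int \<Rightarrow> real" and p :: "int \<Rightarrow> int" where
    "strict_mono \<tau>" "strict_mono p"
    "range \<tau> = range of_int \<union> range (\<lambda>i::int. y0 + of_int (i - 1) * W)"
    "\<And>i. \<tau> (p i) = y0 + of_int (i - 1) * W"
    "\<And>k. k \<notin> range p \<Longrightarrow> \<tau> k \<in> range of_int"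
    "\<And>i. p (i + 1) = p i + sturmian W y0 i + 1"
proof -
  define B where "B = (\<lambda>i::int. y0 + of_int (i - 1) * W)"
  define p where "p = (\<lambda>i. i + \<lfloor>B i\<rfloor>)"
  have BS: "B (i + 1) = B i + W" for i by (simp add: B_def algebra_simps)
  have Bmono: "B i \<le> B j" if "i \<le> j" for i j
    using that \<open>W > 0\<close> by (simp add: B_def)
  have Bn: "B i \<noteq> of_int n" for i n
    using avoid[unfolded line_avoids_lattice_def, rule_format, of n "i - 1"]
    by (auto simp: B_def algebra_simps)
  have pdiff: "j - i \<le> p j - p i" if "i \<le> j" for i j
    using floor_mono[OF Bmono[OF that]] by (simp add: p_def)
  have pmono: "strict_mono p"
  proof (rule strict_monoI)
    show "p i < p j" if "i < j" for i j using pdiff[of i j] that by simp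
  qed
  have "\<exists>i. p i \<le> k \<and> k < p (i + 1)" for k
  proof -
    define i0 where "i0 = - \<bar>k - p 0\<bar>"
    have i0: "p i0 \<le> k" using pdiff[of i0 0] by (simp add: i0_def)
    have "k < p (i0 + int (nat (k - p i0 + 1)))"
      using pdiff[of i0 "i0 + int (nat (k - p i0 + 1))"] i0 by simp
    then have "\<exists>n. k < p (i0 + int n)" by blast
    then obtain n where n: "k < p (i0 + int n)" "\<And>m. m < n \<Longrightarrow> \<not> k < p (i0 + int m)"
      using exists_least_iff[of "\<lambda>n. k < p (i0 + int n)"] by blast
    then have "n \<noteq> 0" using i0 by (auto intro: gr0I)
    then obtain m where "n = Suc m" by (meson not0_implies_Suc)
    then show ?thesis using n(1) n(2)[of m] by (intro exI[of _ "i0 + int m"]) (auto simp: algebra_simps)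
  qed
  then obtain idx where idx: "\<And>k. p (idx k) \<le> k" "\<And>k. k < p (idx k + 1)" by metis
  have idx_eq: "idx k = i" if "p i \<le> k" "k < p (i + 1)" for k i
  proof -
    have "p (idx k) < p (i + 1)" "p i < p (idx k + 1)" using idx[of k] that by linarith+
    then show ?thesis using strict_mono_less[OF pmono] by force
  qed
  define \<tau> where "\<tau> = (\<lambda>k. if p (idx k) = k then B (idx k) else of_int (k - idx k))"
  have tp: "\<tau> (p i) = B i" for i
    using idx_eq[of i "p i"] pdiff[of i "i + 1"] by (simp add: \<tau>_def)
  have tn: "\<tau> k = of_int (k - i)" if "p i < k" "k < p (i + 1)" for i k
    using idx_eq[of i k] that by (simp add: \<tau>_def)
  have between: "B i < of_int (k - i)" "of_int (k - i) < B (i + 1)" if "p i < k" "k < p (i + 1)" for i k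
  proof -
    have "\<lfloor>B i\<rfloor> < k - i" "k - i \<le> \<lfloor>B (i + 1)\<rfloor>" using that by (auto simp: p_def)
    then have "B i < of_int (k - i)" "of_int (k - i) \<le> B (i + 1)"
      by (simp_all only: floor_less_iff le_floor_iff)
    then show "B i < of_int (k - i)" "of_int (k - i) < B (i + 1)"
      using Bn[of "i + 1" "k - i"] by linarith+
  qed
  have "\<tau> k < \<tau> (k + 1)" for k
  proof -
    define i where "i = idx k"
    have i: "p i \<le> k" "k < p (i + 1)" using idx by (auto simp: i_def)
    have BB: "B i < B (i + 1)" using BS \<open>W > 0\<close> by simp
    show ?thesis
    proof (cases "p (i + 1) = k + 1")
      case True
      then have "\<tau> (k + 1) = B (i + 1)" using tp by metis
      then show ?thesis
        using BB tp[of i] tn[of i k] between[of i k] i by (cases "p i = k") auto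
    next
      case False
      then have *: "p i < k + 1" "k + 1 < p (i + 1)" using i by auto
      then show ?thesis
        using tp[of i] tn[of i k] tn[of i "k + 1"] between(1)[of i "k + 1"] i
        by (cases "p i = k") auto
    qed
  qed
  then have "strict_mono \<tau>" by (rule strict_mono_int_stepI)
  moreover have notp: "\<tau> k \<in> range of_int" if "k \<notin> range p" for k
  proof -
    have "p (idx k) \<noteq> k" using that by (metis rangeI)
    then show ?thesis unfolding \<tau>_def by (metis rangeI)
  qed
  moreover have "range \<tau> = range of_int \<union> range B"
  proof (intro equalityI subsetI)
    fix y assume "y \<in> range \<tau>"
    then obtain k where "y = \<tau> k" by blast
    then show "y \<in> range of_int \<union> range B" unfolding \<tau>_def by (metis UnI1 UnI2 rangeI)
  next
    fix y assume "y \<in> range of_int \<union> range B"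
    then consider n where "y = of_int n" | i where "y = B i" by blast
    then show "y \<in> range \<tau>"
    proof cases
      case 1
      define i where "i = \<lfloor>(of_int n - y0) / W\<rfloor> + 1"
      have "of_int (i - 1) \<le> (of_int n - y0) / W" "(of_int n - y0) / W < of_int (i - 1) + 1"
        unfolding i_def by linarith+
      then have "B i \<le> of_int n" "of_int n < B (i + 1)"
        using \<open>W > 0\<close> by (auto simp: B_def field_simps)
      moreover have "B i \<noteq> of_int n" by (rule Bn)
      ultimately have "\<lfloor>B i\<rfloor> < n" "n \<le> \<lfloor>B (i + 1)\<rfloor>"
        by (simp_all only: floor_less_iff le_floor_iff)
      then have "\<tau> (n + i) = of_int n"
        using tn[of i "n + i"] by (simp add: p_def)
      then show ?thesis using 1 by (metis rangeI)
    next
      case 2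
      then show ?thesis using tp by (metis rangeI)
    qed
  qed
  moreover have "p (i + 1) = p i + sturmian W y0 i + 1" for i
    unfolding p_def sturmian_eq_floor_diff B_def by simp
  ultimately show thesis
    using that[of \<tau> p] pmono tp unfolding B_def by blast
qed

lemma syzygy_seq_block_form:
  fixes A S a c :: real
  assumes "A > 0" "S > 0"
    and l: "{t. l t = 0} = range (\<lambda>k::int. a + of_int k * A)"
    and v: "{t. cos (v t) = 0} = range (\<lambda>k::int. c + of_int k * S)"
    and W: "W = S / A" and y0: "y0 = (c - a) / A + W"
    and avoid: "line_avoids_lattice W y0"
    and b: "\<And>i::int. b i = (if sin (v (c + of_int i * S)) < 0 then 1 else 2)"
  shows "non_collision l v \<and> (\<exists>s. syzygy_seq l v s \<and> block_form b (sturmian W y0) s)"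
proof -
  have "W > 0" using assms by simp
  then obtain \<tau> :: "int \<Rightarrow> real" and p :: "int \<Rightarrow> int" where
    \<tau>: "strict_mono \<tau>" and p: "strict_mono p"
    and range: "range \<tau> = range of_int \<union> range (\<lambda>i::int. y0 + of_int (i - 1) * W)"
    and tp: "\<And>i. \<tau> (p i) = y0 + of_int (i - 1) * W"
    and tn: "\<And>k. k \<notin> range p \<Longrightarrow> \<tau> k \<in> range of_int"
    and step: "\<And>i. p (i + 1) = p i + sturmian W y0 i + 1"
    by (rule merge_integers_with_progression[OF _ avoid]) (rule that)
  define \<sigma> where "\<sigma> = (\<lambda>x. a + x * A)"
  have \<sigma>B: "\<sigma> (y0 + of_int (i - 1) * W) = c + of_int i * S" for i
    using \<open>A > 0\<close> by (simp add: \<sigma>_def y0 W field_simps)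
  have lz: "l (\<sigma> (of_int n)) = 0" for n
    using l unfolding \<sigma>_def by blast
  have vz: "cos (v (c + of_int i * S)) = 0" for i
    using v by blast
  have nc: "l (c + of_int i * S) \<noteq> 0" for i
  proof
    assume "l (c + of_int i * S) = 0"
    then obtain n :: int where "c + of_int i * S = a + of_int n * A" using l by blast
    then have "of_int n = (c - a + of_int i * S) / A"
      using \<open>A > 0\<close> by (simp add: field_simps)
    also have "\<dots> = W * of_int (i - 1) + y0"
      using \<open>A > 0\<close> by (simp add: y0 W field_simps)
    finally have "of_int n = W * of_int (i - 1) + y0" .
    then show False using avoid unfolding line_avoids_lattice_def by blast
  qed
  have "non_collision l v"
    unfolding non_collision_def
  proof (intro allI notI, elim conjE)
    fix t assume "l t = 0" "cos (v t) = 0"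
    moreover from this v obtain i :: int where "t = c + of_int i * S" by blast
    ultimately show False using nc by simp
  qed
  moreover define s where "s = (\<lambda>k. syzygy_symbol l v (\<sigma> (\<tau> k)))"
  have "syzygy_seq l v s"
    unfolding syzygy_seq_def
  proof (intro exI conjI allI)
    show "strict_mono (\<lambda>k. \<sigma> (\<tau> k))"
      using \<tau> \<open>A > 0\<close> by (auto simp: strict_mono_def \<sigma>_def)
    have "range (\<lambda>k. \<sigma> (\<tau> k)) = \<sigma> ` range \<tau>" by blast
    also have "\<dots> = range (\<lambda>n::int. \<sigma> (of_int n)) \<union> range (\<lambda>i::int. \<sigma> (y0 + of_int (i - 1) * W))"
      unfolding range by blast
    also have "\<dots> = {t. l t = 0} \<union> {t. cos (v t) = 0}"
      unfolding \<sigma>B l v by (simp add: \<sigma>_def)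
    also have "\<dots> = syzygy_times l v" by (auto simp: syzygy_times_def)
    finally show "range (\<lambda>k. \<sigma> (\<tau> k)) = syzygy_times l v" .
    show "syzygy_symbol l v (\<sigma> (\<tau> k)) = s k" for k by (simp add: s_def)
  qed
  moreover have sp: "s (p i) = b i" for i
    unfolding s_def tp \<sigma>B syzygy_symbol_def b using nc by simp
  have sn: "s k = 3" if "k \<notin> range p" for k
    using tn[OF that] lz by (auto simp: s_def syzygy_symbol_def)
  have "block_form b (sturmian W y0) s"
    unfolding block_form_def
  proof (intro conjI exI allI)
    show "s k \<in> {1, 2, 3}" for k by (simp add: s_def syzygy_symbol_def)
    show "strict_mono p" by fact
    have "s (p i) \<noteq> 3" for i unfolding sp b by simp
    then show "range p = {k. s k \<noteq> 3}" using sn by auto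
    show "s (p i) = b i" "p (i + 1) = p i + sturmian W y0 i + 1" for i by fact+
  qed
  ultimately show ?thesis by blast
qed

lemma shift_zero_times:
  fixes b e S :: real
  assumes "{t. P t} = range (\<lambda>k::int. b + of_int k * S)"
  shows "{t. P (t + e)} = range (\<lambda>k::int. (b - e) + of_int k * S)"
proof -
  have "P t \<longleftrightarrow> (\<exists>k::int. t = b + of_int k * S)" for t using assms by blast
  then show ?thesis by (auto simp: image_iff algebra_simps)
qed

lemma non_collision_line_avoids_lattice:
  fixes A S a c :: real
  assumes "A > 0" and l: "{t. l t = 0} = range (\<lambda>k::int. a + of_int k * A)"
    and v: "{t. cos (v t) = 0} = range (\<lambda>k::int. c + of_int k * S)"
    and W: "W = S / A" and y0: "y0 = (c - a) / A + W" and nc: "non_collision l v"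
  shows "line_avoids_lattice W y0"
  unfolding line_avoids_lattice_def
proof (intro allI notI)
  fix i n :: int assume "of_int n = W * of_int i + y0"
  then have "of_int n * A = (W * of_int i + y0) * A" by simp
  also have "\<dots> = of_int (i + 1) * S + (c - a)"
    using \<open>A > 0\<close> by (simp add: W y0 field_simps)
  finally have "a + of_int n * A = c + of_int (i + 1) * S" by simp
  moreover have "l (a + of_int n * A) = 0" "cos (v (c + of_int (i + 1) * S)) = 0"
    using l v by blast+
  ultimately show False using nc unfolding non_collision_def by metis
qed

lemma syzygy_seq_block_form_non_collision:
  fixes A S a c :: real
  assumes "A > 0" "S > 0"
    and l: "{t. l t = 0} = range (\<lambda>k::int. a + of_int k * A)"
    and v: "{t. cos (v t) = 0} = range (\<lambda>k::int. c + of_int k * S)"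
    and W: "W = S / A" and nc: "non_collision l v"
    and b: "\<And>i::int. b i = (if sin (v (c + of_int i * S)) < 0 then 1 else 2)"
  shows "\<exists>s y0. syzygy_seq l v s \<and> line_avoids_lattice W y0 \<and> block_form b (sturmian W y0) s"
proof -
  have "line_avoids_lattice W ((c - a) / A + W)"
    by (rule non_collision_line_avoids_lattice[OF \<open>A > 0\<close> l v W refl nc])
  with syzygy_seq_block_form[OF \<open>A > 0\<close> \<open>S > 0\<close> l v W refl this b] show ?thesis by blast
qed

lemma syzygy_seq_rotation_only:
  assumes "S > 0" and l: "\<And>t. l t \<noteq> 0"
    and v: "{t. cos (v t) = 0} = range (\<lambda>k::int. b + of_int k * S)"
    and sin: "\<And>k::int. sin (v (b + of_int k * S)) = (if even k then 1 else -1)"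
  shows "\<exists>s. syzygy_seq l v s \<and> pattern_P s"
proof (intro exI conjI)
  let ?\<tau> = "\<lambda>k::int. b + of_int k * S"
  show "syzygy_seq l v (\<lambda>k. syzygy_symbol l v (?\<tau> k))"
    unfolding syzygy_seq_def
  proof (intro exI conjI allI)
    show "strict_mono ?\<tau>" using \<open>S > 0\<close> by (auto simp: strict_mono_def)
    show "range ?\<tau> = syzygy_times l v" using v l by (auto simp: syzygy_times_def)
  qed simp
  show "pattern_P (\<lambda>k. syzygy_symbol l v (?\<tau> k))"
    unfolding pattern_P_def syzygy_symbol_def sin using l by simp
qed


section \<open>The separated two-center problem\<close>

lemma regular_value_force_nonzero:
  assumes reg: "regular_value H c" and H: "\<And>z. H z = (snd z)\<^sup>2 / 2 + U (fst z)"
    and U: "\<And>y. (U has_real_derivative - F y) (at y)" and x: "U x = c"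
  shows "F x \<noteq> 0"
proof
  assume F: "F x = 0"
  have "H (x, 0) = c" by (simp add: H x)
  then obtain D where D: "(H has_derivative D) (at (x, 0))" "D \<noteq> (\<lambda>_. 0)"
    using reg unfolding regular_value_def by blast
  have "(U has_derivative (\<lambda>_. 0)) (at (fst (x, 0 :: real)))"
    using U[of x] F unfolding has_field_derivative_def by (simp add: lambda_zero)
  then have "((\<lambda>z. U (fst z)) has_derivative (\<lambda>_. 0)) (at (x, 0 :: real))"
    using has_derivative_compose[OF has_derivative_fst[OF has_derivative_ident]] by blast
  moreover have "((\<lambda>z::real \<times> real. (snd z)\<^sup>2 / 2) has_derivative (\<lambda>_. 0)) (at (x, 0))"
    by (auto intro!: derivative_eq_intros)
  ultimately have "((\<lambda>z. (snd z)\<^sup>2 / 2 + U (fst z)) has_derivative (\<lambda>_. 0 + 0)) (at (x, 0))"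
    by (intro has_derivative_add)
  then have "(H has_derivative (\<lambda>_. 0)) (at (x, 0))"
    using ext[of H, OF H] by simp
  with D show False using has_derivative_unique by blast
qed

lemma continuous_IVT_values:
  fixes x :: "real \<Rightarrow> real"
  assumes "continuous_on UNIV x" "x s \<le> y" "y \<le> x t"
  obtains u where "x u = y"
proof -
  have "connected (range x)" using assms(1) connected_UNIV by (rule connected_continuous_image)
  then have "y \<in> range x" using assms by (meson connectedD_interval rangeI)
  then show thesis using that by blast
qed

lemma newton_equilibrium_of_constant:
  assumes sol: "newton_solution F x p" and "\<And>t. x t = c"
  shows "F c = 0"
proof -
  have "x = (\<lambda>_. c)" using assms(2) by auto
  then have p: "p t = 0" for t
    using newton_solutionD(1)[OF sol, of t] DERIV_const DERIV_unique by metis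
  then have "p = (\<lambda>_. 0)" by auto
  then show "F c = 0"
    using newton_solutionD(2)[OF sol, of 0] DERIV_const DERIV_unique assms(2) by metis
qed

lemma cos_zeros_gap:
  fixes c c' :: real
  assumes "cos c = 0" "c < c'" "c' < c + pi"
  shows "cos c' \<noteq> 0"
proof -
  have "sin c \<noteq> 0" using assms(1) sin_zero_abs_cos_one by force
  moreover have "sin (c' - c) > 0" using assms by (intro sin_gt_zero) auto
  moreover have "cos c' = - sin c * sin (c' - c)"
    using cos_add[of c "c' - c"] assms(1) by simp
  ultimately show ?thesis by simp
qed

lemma sin_attains_between_cos_zeros:
  fixes c c' s :: real
  assumes "cos c = 0" "cos c' = 0" "c < c'" "\<bar>s\<bar> \<le> 1"
  obtains y where "c \<le> y" "y \<le> c'" "sin y = s"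
proof -
  have le: "c + pi \<le> c'" using cos_zeros_gap[of c c'] assms by force
  have "(sin c)\<^sup>2 = 1" using sin_cos_squared_add[of c] assms(1) by simp
  then have "sin c = 1 \<or> sin c = -1" by (simp add: power2_eq_1_iff)
  then have "\<exists>y. c \<le> y \<and> y \<le> c + pi \<and> sin y = s"
  proof
    assume "sin c = 1"
    then show ?thesis
      by (intro IVT2') (use assms in \<open>auto intro!: continuous_intros\<close>)
  next
    assume "sin c = -1"
    then show ?thesis
      by (intro IVT') (use assms in \<open>auto intro!: continuous_intros\<close>)
  qed
  then show thesis using that le by force
qed

lemma continuous_on_cylmap: "continuous_on A cylmap"
  unfolding cylmap_def[abs_def] by (intro continuous_intros)

locale two_center =
  fixes d m1 m2 h :: real
  assumes pos: "d > 0" "m1 > 0" "m2 > 0" and neg: "h < 0"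
begin

definition Ulam :: "real \<Rightarrow> real" where
  "Ulam c = - d * (m1 + m2) * c - h * d\<^sup>2 * c\<^sup>2"

definition Flam :: "real \<Rightarrow> real" where
  "Flam x = d * (m1 + m2) * sinh x + 2 * h * d\<^sup>2 * cosh x * sinh x"

definition Vnu :: "real \<Rightarrow> real" where
  "Vnu s = d * (m1 - m2) * s + h * d\<^sup>2 * s\<^sup>2"

definition Fnu :: "real \<Rightarrow> real" where
  "Fnu x = - (d * (m1 - m2) * cos x + 2 * h * d\<^sup>2 * sin x * cos x)"

lemma lam_solution_iff: "lam_solution d m1 m2 h l pl \<longleftrightarrow> newton_solution Flam l pl"
  by (simp add: lam_solution_def newton_solution_def Flam_def)

lemma nu_solution_iff: "nu_solution d m1 m2 h v pv \<longleftrightarrow> newton_solution Fnu v pv"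
  by (simp add: nu_solution_def newton_solution_def Fnu_def)

lemma Hlam_eq: "Hlam d m1 m2 h z = (snd z)\<^sup>2 / 2 + Ulam (cosh (fst z))"
  by (simp add: Hlam_def Ulam_def)

lemma Hnu_eq: "Hnu d m1 m2 h z = (snd z)\<^sup>2 / 2 + Vnu (sin (fst z))"
  by (simp add: Hnu_def Vnu_def)

lemma hd2_neg: "h * d\<^sup>2 < 0"
  using pos neg by (simp add: mult_neg_pos)

lemma Ulam_deriv: "((\<lambda>x. Ulam (cosh x)) has_real_derivative - Flam x) (at x)"
  unfolding Ulam_def Flam_def by (auto intro!: derivative_eq_intros simp: algebra_simps)

lemma Vnu_deriv: "((\<lambda>x. Vnu (sin x)) has_real_derivative - Fnu x) (at x)"
  unfolding Vnu_def Fnu_def by (auto intro!: derivative_eq_intros simp: algebra_simps)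

lemma Flam_lipschitz: "locally_lipschitz_real Flam"
proof (rule locally_lipschitz_realI)
  show "(Flam has_real_derivative
      d * (m1 + m2) * cosh x + 2 * h * d\<^sup>2 * (sinh x * sinh x + cosh x * cosh x)) (at x)" for x
    unfolding Flam_def[abs_def] by (auto intro!: derivative_eq_intros simp: algebra_simps)
  show "continuous_on UNIV (\<lambda>x::real. d * (m1 + m2) * cosh x + 2 * h * d\<^sup>2 * (sinh x * sinh x + cosh x * cosh x))"
    by (intro continuous_intros)
qed

lemma Fnu_lipschitz: "\<bar>Fnu x - Fnu y\<bar> \<le> (\<bar>d * (m1 - m2)\<bar> + 4 * \<bar>h * d\<^sup>2\<bar>) * \<bar>x - y\<bar>"
proof -
  have "norm (Fnu x - Fnu y) \<le> (\<bar>d * (m1 - m2)\<bar> + 4 * \<bar>h * d\<^sup>2\<bar>) * norm (x - y)"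
  proof (rule field_differentiable_bound[of UNIV])
    fix x
    show "(Fnu has_real_derivative
        (d * (m1 - m2)) * sin x + (h * d\<^sup>2) * (2 * (sin x * sin x - cos x * cos x))) (at x)"
      unfolding Fnu_def[abs_def] by (auto intro!: derivative_eq_intros simp: algebra_simps)
    have "\<bar>sin x * sin x - cos x * cos x\<bar> \<le> \<bar>sin x\<bar> * \<bar>sin x\<bar> + \<bar>cos x\<bar> * \<bar>cos x\<bar>"
      unfolding abs_mult[symmetric] by (rule abs_triangle_ineq4)
    also have "\<dots> \<le> 1 + 1"
      by (intro add_mono mult_le_one) auto
    finally have "\<bar>2 * (sin x * sin x - cos x * cos x)\<bar> \<le> 4" by simp
    then have "\<bar>(h * d\<^sup>2) * (2 * (sin x * sin x - cos x * cos x))\<bar> \<le> \<bar>h * d\<^sup>2\<bar> * 4"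
      unfolding abs_mult[of "h * d\<^sup>2"] by (rule mult_left_mono) simp
    moreover have "\<bar>(d * (m1 - m2)) * sin x\<bar> \<le> \<bar>d * (m1 - m2)\<bar> * 1"
      unfolding abs_mult[of "d * (m1 - m2)"] by (rule mult_left_mono) auto
    ultimately show "norm ((d * (m1 - m2)) * sin x + (h * d\<^sup>2) * (2 * (sin x * sin x - cos x * cos x)))
        \<le> \<bar>d * (m1 - m2)\<bar> + 4 * \<bar>h * d\<^sup>2\<bar>"
      unfolding real_norm_def by linarith
  qed auto
  then show ?thesis by simp
qed

lemma Fnu_locally_lipschitz: "locally_lipschitz_real Fnu"
  unfolding locally_lipschitz_real_def by (intro allI exI ballI) (rule Fnu_lipschitz)

lemma Flam_odd: "Flam (2 * 0 - y) = - Flam y"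
  by (simp add: Flam_def)

lemma Fnu_odd:
  assumes "cos c = 0"
  shows "Fnu (2 * c - y) = - Fnu y"
proof -
  have "cos (2 * c) = -1" "sin (2 * c) = 0"
    using assms by (simp_all add: cos_double_cos sin_double)
  then show ?thesis by (simp add: Fnu_def cos_diff sin_diff)
qed

lemma Vnu_tangent:
  assumes "d * (m1 - m2) + 2 * (h * d\<^sup>2) * s0 = 0"
  shows "Vnu s \<le> Vnu s0"
proof -
  have "Vnu s - Vnu s0 = (d * (m1 - m2) + 2 * (h * d\<^sup>2) * s0) * (s - s0) + (h * d\<^sup>2) * (s - s0)\<^sup>2"
    by (simp add: Vnu_def power2_eq_square algebra_simps)
  also have "\<dots> \<le> 0" using hd2_neg by (simp add: assms mult_nonpos_nonneg)
  finally show ?thesis by simp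
qed

lemma Ulam_level_unique:
  assumes "Ulam 1 < E" "1 < a" "1 < b" "Ulam a = E" "Ulam b = E"
  shows "a = b"
proof -
  have *: False if "Ulam a = E" "Ulam b = E" "1 < a" "a < b" for a b
  proof -
    have "(b - a) * Ulam 1 + (a - 1) * Ulam b - (b - 1) * Ulam a
        = (- (h * d\<^sup>2)) * ((a - 1) * ((b - a) * (b - 1)))"
      by (simp add: Ulam_def power2_eq_square algebra_simps)
    also have "\<dots> > 0" using hd2_neg that by (intro mult_pos_pos) auto
    finally have "(b - a) * E < (b - a) * Ulam 1" unfolding that by (simp add: algebra_simps)
    then show False using that assms(1) by simp
  qed
  show ?thesis
    using *[OF assms(4,5,2)] *[OF assms(5,4,3)] by (cases a b rule: linorder_cases) auto
qed

lemma lam_regular: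
  assumes "regular_value (Hlam d m1 m2 h) (- g)" "Ulam (cosh x) = - g"
  shows "Flam x \<noteq> 0"
  by (rule regular_value_force_nonzero[OF assms(1) Hlam_eq Ulam_deriv assms(2)])

lemma nu_regular:
  assumes "regular_value (Hnu d m1 m2 h) g" "Vnu (sin x) = g"
  shows "Fnu x \<noteq> 0"
  by (rule regular_value_force_nonzero[OF assms(1) Hnu_eq Vnu_deriv assms(2)])

lemma lam_reaches_zero:
  assumes sol: "newton_solution Flam l pl" and level: "\<And>t. (pl t)\<^sup>2 / 2 + Ulam (cosh (l t)) = - g"
    and reg: "regular_value (Hlam d m1 m2 h) (- g)" and U1: "Ulam 1 < - g"
    and T: "T > 0" "\<And>t. l (t + T) = l t"
  obtains a where "l a = 0"
proof (rule ccontr)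
  assume "\<not> thesis"
  then have nz: "l t \<noteq> 0" for t using that by blast
  obtain a b where ab: "\<And>t. l a \<le> l t" "\<And>t. l t \<le> l b" "pl a = 0" "pl b = 0"
    using periodic_newton_solution_extrema[OF sol T] by metis
  have "\<not> (l a \<le> 0 \<and> 0 \<le> l b)"
    using continuous_IVT_values[OF newton_solutionD(5)[OF sol]] nz by metis
  then have sign: "l a > 0 \<and> l b > 0 \<or> l a < 0 \<and> l b < 0" using ab(1)[of b] by linarith
  have "cosh (l a) = cosh (l b)"
  proof (rule Ulam_level_unique[OF U1])
    show "1 < cosh (l a)" "1 < cosh (l b)"
      using nz cosh_real_ge_1 cosh_real_one_iff by (metis order_le_less)+
    show "Ulam (cosh (l a)) = - g" "Ulam (cosh (l b)) = - g"
      using level[of a] level[of b] ab by simp_all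
  qed
  then have "l a = l b" using sign by auto
  then have const: "l t = l a" for t using ab(1)[of t] ab(2)[of t] by simp
  have "Flam (l a) = 0" by (rule newton_equilibrium_of_constant[OF sol const])
  moreover have "Flam (l a) \<noteq> 0"
    using level[of a] ab by (intro lam_regular[OF reg]) simp
  ultimately show False by simp
qed

lemma lam_zero_times:
  assumes sol: "newton_solution Flam l pl" and level: "\<And>t. (pl t)\<^sup>2 / 2 + Ulam (cosh (l t)) = - g"
    and reg: "regular_value (Hlam d m1 m2 h) (- g)" and U1: "Ulam 1 < - g"
    and per: "min_period (\<lambda>t. (l t, pl t)) T"
  obtains a where "{t. l t = 0} = range (\<lambda>k::int. a + of_int k * (T / 2))"
proof -
  have "T > 0" "\<And>t. l (t + T) = l t" using per by (auto simp: min_period_def)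
  then obtain a where "l a = 0"
    using lam_reaches_zero[OF sol level reg U1] by blast
  then show thesis
    by (intro that oscillation_center_times[OF sol Flam_lipschitz Flam_odd Ulam_deriv per])
qed

lemma nu_oscillation_zero_times:
  assumes sol: "newton_solution Fnu v pv" and level: "\<And>t. (pv t)\<^sup>2 / 2 + Vnu (sin (v t)) = g"
    and reg: "regular_value (Hnu d m1 m2 h) g" and s: "\<bar>s\<bar> \<le> 1" "Vnu s > g"
    and per: "min_period (\<lambda>t. cylmap (v t, pv t)) T"
  obtains b c where "{t. cos (v t) = 0} = range (\<lambda>k::int. b + of_int k * (T / 2))"
    "\<And>t. cos (v t) = 0 \<Longrightarrow> v t = c"
proof -
  have le: "Vnu (sin (v t)) \<le> g" for t
    using level[of t] zero_le_power2[of "pv t"] by linarith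
  have hit: "\<exists>u. v u = y" if "v t \<le> y" "y \<le> v t'" for t t' y
    using continuous_IVT_values[OF newton_solutionD(5)[OF sol] that] by metis
  have avoid: False if "v t \<le> y" "y \<le> v t'" "sin y = s" for t t' y
    using hit[OF that(1,2)] le that(3) s(2) by (metis not_le)
  have narrow: "v t' < v t + 2 * pi" for t t'
  proof (rule ccontr)
    assume "\<not> v t' < v t + 2 * pi"
    define k where "k = \<lceil>(v t - arcsin s) / (2 * pi)\<rceil>"
    have "(v t - arcsin s) / (2 * pi) \<le> of_int k" "of_int k < (v t - arcsin s) / (2 * pi) + 1"
      unfolding k_def by linarith+
    then have k: "v t \<le> arcsin s + 2 * pi * of_int k" "arcsin s + 2 * pi * of_int k \<le> v t + 2 * pi"
      by (simp_all add: field_simps)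
    have "sin (arcsin s + 2 * pi * of_int k) = s"
      using s(1) by (simp add: sin_add abs_le_iff)
    then show False using avoid[of t _ t'] k \<open>\<not> v t' < v t + 2 * pi\<close> by force
  qed
  have cyl: "v (t + S) = v t \<and> pv (t + S) = pv t"
    if "cylmap (v (t + S), pv (t + S)) = cylmap (v t, pv t)" for t S
  proof -
    have "sin (v (t + S)) = sin (v t) \<and> cos (v (t + S)) = cos (v t)" "pv (t + S) = pv t"
      using that by (auto simp: cylmap_def)
    then obtain n :: int where n: "v (t + S) = v t + 2 * pi * n" using sin_cos_eq_iff by blast
    have "(2 * pi) * n < (2 * pi) * 1" "(2 * pi) * (- 1) < (2 * pi) * n"
      using narrow[of "t + S" t] narrow[of t "t + S"] by (auto simp: n)
    then have "real_of_int n < 1" "-1 < real_of_int n" by (simp_all only: mult_less_cancel_left_pos pi_gt_zero zero_less_mult_iff zero_less_numeral simp_thms)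
    then have "n = 0" by linarith
    then show ?thesis using n \<open>pv (t + S) = pv t\<close> by simp
  qed
  have per': "min_period (\<lambda>t. (v t, pv t)) T"
    using per cyl unfolding min_period_def by (metis prod.inject)
  then have T: "T > 0" "\<And>t. v (t + T) = v t" by (auto simp: min_period_def)
  obtain a b where ab: "\<And>t. v a \<le> v t" "\<And>t. v t \<le> v b" "pv a = 0" "pv b = 0"
    using periodic_newton_solution_extrema[OF sol T] by metis
  have ends: "Vnu (sin (v a)) = g" "Vnu (sin (v b)) = g"
    using level[of a] level[of b] ab by simp_all
  have "v a \<noteq> v b"
  proof
    assume "v a = v b"
    then have const: "v t = v a" for t using ab(1)[of t] ab(2)[of t] by simp
    have "Fnu (v a) = 0" by (rule newton_equilibrium_of_constant[OF sol const])
    then show False using nu_regular[OF reg ends(1)] by simp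
  qed
  then have "v a < v b" using ab(1)[of b] by simp
  then have "\<exists>z. v a < z \<and> z < v b \<and> ((\<lambda>x. Vnu (sin x)) has_real_derivative 0) (at z)"
    using Vnu_deriv ends
    by (intro Rolle) (auto intro!: continuous_at_imp_continuous_on DERIV_isCont simp: real_differentiable_def)
  then obtain z where z: "v a < z" "z < v b" "((\<lambda>x. Vnu (sin x)) has_real_derivative 0) (at z)"
    by blast
  then have "Fnu z = 0" using Vnu_deriv DERIV_unique by fastforce
  then have "cos z * (d * (m1 - m2) + 2 * (h * d\<^sup>2) * sin z) = 0"
    by (simp add: Fnu_def algebra_simps)
  moreover obtain u where u: "v u = z" using hit[of a z b] z by auto
  \<comment> \<open>Otherwise \<open>sin z\<close> is the vertex of the parabola \<open>Vnu\<close>, whose value exceeds \<open>g\<close>.\<close>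
  moreover have "d * (m1 - m2) + 2 * (h * d\<^sup>2) * sin z \<noteq> 0"
    using Vnu_tangent[of "sin z" s] le[of u] s(2) u by auto
  ultimately have c: "cos (v u) = 0" by simp
  have same: "v t = v u" if t: "cos (v t) = 0" for t
  proof (rule ccontr)
    assume "v t \<noteq> v u"
    then consider "v t < v u" | "v u < v t" by linarith
    then show False
    proof cases
      case 1
      then show False using sin_attains_between_cos_zeros[OF t c 1 s(1)] avoid by metis
    next
      case 2
      then show False using sin_attains_between_cos_zeros[OF c t 2 s(1)] avoid by metis
    qed
  qed
  have "{t. cos (v t) = 0} = {t. v t = v u}" using same c by metis
  also have "\<dots> = range (\<lambda>k::int. u + of_int k * (T / 2))"
    by (rule oscillation_center_times[OF sol Fnu_locally_lipschitz Fnu_odd[OF c] Vnu_deriv per' refl])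
  finally show thesis using that same by blast
qed

lemma nu_rotation_zero_times:
  assumes sol: "newton_solution Fnu v pv" and level: "\<And>t. (pv t)\<^sup>2 / 2 + Vnu (sin (v t)) = g"
    and V: "\<And>s. \<bar>s\<bar> \<le> 1 \<Longrightarrow> Vnu s < g"
    and per: "min_period (\<lambda>t. cylmap (v t, pv t)) T"
  obtains b where "{t. cos (v t) = 0} = range (\<lambda>k::int. b + of_int k * (T / 2))"
    "\<And>k::int. sin (v (b + of_int k * (T / 2))) = (if even k then 1 else -1)"
proof -
  have "continuous_on {-1..1} Vnu" unfolding Vnu_def by (intro continuous_intros)
  then obtain s where s: "s \<in> {-1..1}" "\<forall>s'\<in>{-1..1}. Vnu s' \<le> Vnu s"
    using continuous_attains_sup[of "{-1..1}" Vnu] by auto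
  define \<delta> where "\<delta> = sqrt (2 * (g - Vnu s))"
  have gs: "g - Vnu s > 0" using V[of s] s by auto
  then have "\<delta> > 0" by (simp add: \<delta>_def)
  have speed: "\<delta> \<le> \<bar>pv t\<bar>" for t
  proof -
    have "Vnu (sin (v t)) \<le> Vnu s" using s(2) by simp
    then have "2 * (g - Vnu s) \<le> (pv t)\<^sup>2" unfolding level[of t, symmetric] by simp
    then show ?thesis unfolding \<delta>_def using real_sqrt_le_mono by fastforce
  qed
  have nz: "pv t \<noteq> 0" for t using speed[of t] \<open>\<delta> > 0\<close> by auto
  have same: "\<not> (pv t \<le> 0 \<and> 0 \<le> pv t')" for t t'
    using continuous_IVT_values[OF newton_solutionD(6)[OF sol]] nz by metis
  define e where "e = sgn (pv 0)"
  have e: "e = 1 \<or> e = -1" using nz[of 0] by (auto simp: e_def sgn_if)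
  have "e * pv t = \<bar>pv t\<bar>" for t
    using same[of t 0] same[of 0 t] by (auto simp: e_def sgn_if)
  then have speed': "e * pv t \<ge> \<delta>" for t using speed by simp
  have "cos (pi / 2) = (0::real)" by simp
  then obtain b where b: "\<And>k::int. v (b + of_int k * (T / 2)) = pi / 2 + e * of_int k * pi"
    "\<And>t (j::int). v t = pi / 2 + of_int j * pi \<Longrightarrow> \<exists>k::int. t = b + of_int k * (T / 2)"
    using rotation_half_turn_times[OF sol Fnu_locally_lipschitz Fnu_odd _ Vnu_deriv _ per e \<open>\<delta> > 0\<close> speed',
        of "pi / 2"]
    by (auto simp: Fnu_def)
  have sin_eq: "sin (v (b + of_int k * (T / 2))) = (if even k then 1 else -1)" for k
  proof -
    have "sin (v (b + of_int k * (T / 2))) = cos (e * of_int k * pi)"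
      unfolding b(1) by (simp add: sin_add)
    also have "\<dots> = cos (pi * of_int k)"
      using e by (auto simp: mult.commute)
    finally show ?thesis by simp
  qed
  have "{t. cos (v t) = 0} = range (\<lambda>k::int. b + of_int k * (T / 2))"
  proof (intro equalityI subsetI)
    fix t assume "t \<in> {t. cos (v t) = 0}"
    then obtain j :: int where "v t = pi / 2 + of_int j * pi"
      unfolding cos_zero_iff_int2 by auto
    then show "t \<in> range (\<lambda>k::int. b + of_int k * (T / 2))" using b(2) by blast
  next
    fix t assume "t \<in> range (\<lambda>k::int. b + of_int k * (T / 2))"
    then have "(sin (v t))\<^sup>2 = 1" using sin_eq by auto
    then show "t \<in> {t. cos (v t) = 0}" using sin_cos_squared_add[of "v t"] by simp
  qed
  then show thesis using that sin_eq by blast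
qed


section \<open>Existence of orbits and the type of the torus\<close>

lemma Flam_solution_exists:
  assumes "p0\<^sup>2 / 2 + Ulam (cosh x0) = - g"
  obtains l pl where "newton_solution Flam l pl" "l 0 = x0" "pl 0 = p0"
proof -
  define \<alpha> \<beta> where "\<alpha> = - (h * d\<^sup>2)" and "\<beta> = d * (m1 + m2)"
  have ab: "\<alpha> > 0" "\<beta> > 0" using hd2_neg pos by (auto simp: \<alpha>_def \<beta>_def)
  have U: "Ulam c = c * (\<alpha> * c - \<beta>)" for c
    by (simp add: Ulam_def \<alpha>_def \<beta>_def power2_eq_square algebra_simps)
  define C where "C = 1 + (\<beta> + \<bar>g\<bar>) / \<alpha>"
  have C: "C \<ge> 1" using ab by (simp add: C_def)
  have aC: "\<alpha> * C - \<beta> = \<alpha> + \<bar>g\<bar>" using ab by (simp add: C_def field_simps)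
  have UC: "Ulam c > - g" if "c \<ge> C" for c
  proof -
    have "\<alpha> * C \<le> \<alpha> * c" using that ab by simp
    then have "\<alpha> + \<bar>g\<bar> \<le> \<alpha> * c - \<beta>" using aC by linarith
    have "- g < 1 * (\<alpha> + \<bar>g\<bar>)" using ab(1) abs_ge_minus_self[of g] by simp
    also have "\<dots> \<le> c * (\<alpha> * c - \<beta>)"
      using C that ab \<open>\<alpha> + \<bar>g\<bar> \<le> \<alpha> * c - \<beta>\<close> by (intro mult_mono) auto
    finally show ?thesis unfolding U .
  qed
  define R where "R = arcosh C"
  have R: "cosh R = C" "R \<ge> 0" using C by (simp_all add: R_def)
  have FR: "Flam R \<le> 0"
  proof -
    have "Flam R = sinh R * (\<beta> - 2 * \<alpha> * C)"
      unfolding Flam_def R(1)[symmetric] \<alpha>_def \<beta>_def by (simp add: algebra_simps)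
    moreover have "\<beta> - 2 * \<alpha> * C \<le> 0" using aC ab C by (simp add: algebra_simps)
    ultimately show ?thesis using R(2) by (simp add: mult_nonneg_nonpos)
  qed
  \<comment> \<open>Freezing the force outside \<open>[-R, R]\<close> makes it globally Lipschitz; since it points inwards
    there, energy conservation keeps the truncated orbit inside.\<close>
  define cl where "cl = (\<lambda>x. max (- R) (min R x))"
  have cl: "cl x \<in> {-R..R}" "\<bar>cl x - cl y\<bar> \<le> \<bar>x - y\<bar>" for x y
    using R(2) by (auto simp: cl_def)
  have cl_id: "cl x = x" if "\<bar>x\<bar> \<le> R" for x using that by (auto simp: cl_def)
  define G where "G = (\<lambda>x. Flam (cl x))"
  obtain K0 where K0: "\<forall>x\<in>{-R..R}. \<forall>y\<in>{-R..R}. \<bar>Flam x - Flam y\<bar> \<le> K0 * \<bar>x - y\<bar>"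
    using Flam_lipschitz unfolding locally_lipschitz_real_def by blast
  have lipG: "\<bar>G x - G y\<bar> \<le> \<bar>K0\<bar> * \<bar>x - y\<bar>" for x y
  proof -
    have "\<bar>G x - G y\<bar> \<le> K0 * \<bar>cl x - cl y\<bar>" unfolding G_def using K0 cl(1) by blast
    also have "\<dots> \<le> \<bar>K0\<bar> * \<bar>x - y\<bar>" by (intro mult_mono cl(2)) auto
    finally show ?thesis .
  qed
  obtain l pl where sol: "newton_solution G l pl" and init: "l 0 = x0" "pl 0 = p0"
    using newton_solution_exists[OF lipG] by (metis abs_ge_zero)
  have "\<bar>K0\<bar>-lipschitz_on UNIV G"
    using lipG by (auto intro!: lipschitz_onI simp: dist_norm)
  then have "continuous_on UNIV (\<lambda>x. - G x)"
    by (intro continuous_intros lipschitz_on_continuous_on)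
  then obtain P where P: "(P has_real_derivative - G x) (at x)" for x
    using antiderivative_exists[of "\<lambda>x. - G x"] has_real_derivative_iff_has_vector_derivative by metis
  have eq: "P x - Ulam (cosh x) = P 0 - Ulam (cosh 0)" if "\<bar>x\<bar> \<le> R" for x
  proof -
    have "((\<lambda>x. P x - Ulam (cosh x)) has_real_derivative 0) (at y within {-R..R})" if "y \<in> {-R..R}" for y
    proof (rule has_field_derivative_at_within)
      have "G y = Flam y" using that cl_id[of y] by (auto simp: G_def)
      then show "((\<lambda>x. P x - Ulam (cosh x)) has_real_derivative 0) (at y)"
        using DERIV_diff[OF P[of y] Ulam_deriv[of y]] by simp
    qed
    then have "\<exists>k. \<forall>y\<in>{-R..R}. P y - Ulam (cosh y) = k"
      by (rule has_field_derivative_zero_constant[OF convex_real_interval(5)])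
    then obtain k where k: "\<And>y. y \<in> {-R..R} \<Longrightarrow> P y - Ulam (cosh y) = k" by blast
    show ?thesis using k[of x] k[of 0] that R(2) by (simp add: abs_le_iff)
  qed
  have outside: "P x > - g + (P 0 - Ulam (cosh 0))" if "\<bar>x\<bar> \<ge> R" for x
  proof -
    have ends: "P R > - g + (P 0 - Ulam (cosh 0))" "P (- R) > - g + (P 0 - Ulam (cosh 0))"
      using eq[of R] eq[of "- R"] UC[of C] R by auto
    show ?thesis
    proof (cases "x \<ge> R")
      case True
      have "P R \<le> P x"
      proof (rule DERIV_nonneg_imp_nondecreasing[OF True])
        fix y assume "R \<le> y"
        then have "cl y = R" using R(2) by (simp add: cl_def)
        then show "\<exists>D. (P has_real_derivative D) (at y) \<and> 0 \<le> D"
          using P[of y] FR by (auto simp: G_def)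
      qed
      then show ?thesis using ends by linarith
    next
      case False
      then have x: "x \<le> - R" using that by linarith
      have "P (- R) \<le> P x"
      proof (rule DERIV_nonpos_imp_nonincreasing[OF x])
        fix y assume "y \<le> - R"
        then have "cl y = - R" using R(2) by (simp add: cl_def)
        then show "\<exists>D. (P has_real_derivative D) (at y) \<and> D \<le> 0"
          using P[of y] FR Flam_odd[of R] by (auto simp: G_def)
      qed
      then show ?thesis using ends by linarith
    qed
  qed
  have x0: "\<bar>x0\<bar> \<le> R"
  proof (rule ccontr)
    assume "\<not> \<bar>x0\<bar> \<le> R"
    then have "cosh R \<le> cosh \<bar>x0\<bar>" using R(2) by (subst cosh_real_nonneg_le_iff) auto
    then have "C \<le> cosh x0" unfolding R(1) by simp
    then show False using UC assms zero_le_power2[of p0] by fastforce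
  qed
  have "\<bar>l t\<bar> \<le> R" for t
  proof (rule ccontr)
    assume "\<not> \<bar>l t\<bar> \<le> R"
    then have "- g + (P 0 - Ulam (cosh 0)) < (pl t)\<^sup>2 / 2 + P (l t)"
      using outside[of "l t"] zero_le_power2[of "pl t"] by linarith
    also have "\<dots> = p0\<^sup>2 / 2 + P x0"
      using newton_solution_energy[OF sol P, of t 0] init by simp
    also have "\<dots> = - g + (P 0 - Ulam (cosh 0))"
      using eq[OF x0] assms by simp
    finally show False by simp
  qed
  then have "newton_solution Flam l pl"
    using sol by (simp add: newton_solution_def G_def cl_id)
  then show thesis using that init by blast
qed

lemma lam_level_orbit:
  assumes comp: "Cl \<in> components (lam_level d m1 m2 h g)" and z: "(x0, p0) \<in> Cl"
  obtains l pl where "newton_solution Flam l pl" "\<And>t. (l t, pl t) \<in> Cl"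
proof -
  have sub: "Cl \<subseteq> lam_level d m1 m2 h g" by (rule in_components_subset[OF comp])
  then have z': "p0\<^sup>2 / 2 + Ulam (cosh x0) = - g" using z by (auto simp: lam_level_def Hlam_eq)
  obtain l pl where sol: "newton_solution Flam l pl" and init: "l 0 = x0" "pl 0 = p0"
    using Flam_solution_exists[OF z'] by metis
  have "range (\<lambda>t. (l t, pl t)) \<subseteq> Cl"
  proof (rule components_maximal[OF comp])
    show "connected (range (\<lambda>t. (l t, pl t)))"
      by (intro connected_continuous_image continuous_intros newton_solutionD[OF sol]) simp
    show "range (\<lambda>t. (l t, pl t)) \<subseteq> lam_level d m1 m2 h g"
      using newton_solution_energy[OF sol Ulam_deriv, of _ 0] init z'
      by (auto simp: lam_level_def Hlam_eq)
    show "Cl \<inter> range (\<lambda>t. (l t, pl t)) \<noteq> {}" using z init by blast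
  qed
  then show thesis using that sol by blast
qed

lemma nu_levelD:
  assumes "cylmap z \<in> nu_level d m1 m2 h g"
  shows "(snd z)\<^sup>2 / 2 + Vnu (sin (fst z)) = g"
  using assms by (auto simp: nu_level_def Hnu_eq cylmap_def)

lemma nu_levelI: "(snd z)\<^sup>2 / 2 + Vnu (sin (fst z)) = g \<Longrightarrow> cylmap z \<in> nu_level d m1 m2 h g"
  by (auto simp: nu_level_def Hnu_eq)

lemma nu_level_orbit:
  assumes comp: "Cv \<in> components (nu_level d m1 m2 h g)" and z: "cylmap (x0, p0) \<in> Cv"
  obtains v pv where "newton_solution Fnu v pv" "\<And>t. cylmap (v t, pv t) \<in> Cv"
proof -
  have sub: "Cv \<subseteq> nu_level d m1 m2 h g" by (rule in_components_subset[OF comp])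
  then have z': "p0\<^sup>2 / 2 + Vnu (sin x0) = g" using z nu_levelD[of "(x0, p0)"] by auto
  have "\<bar>d * (m1 - m2)\<bar> + 4 * \<bar>h * d\<^sup>2\<bar> \<ge> 0" by simp
  then obtain v pv where sol: "newton_solution Fnu v pv" and init: "v 0 = x0" "pv 0 = p0"
    using newton_solution_exists[OF Fnu_lipschitz] by metis
  have "range (\<lambda>t. cylmap (v t, pv t)) \<subseteq> Cv"
  proof (rule components_maximal[OF comp])
    show "connected (range (\<lambda>t. cylmap (v t, pv t)))"
      by (intro connected_continuous_image continuous_on_compose2[OF continuous_on_cylmap[of UNIV]]
          continuous_intros newton_solutionD[OF sol]) auto
    show "range (\<lambda>t. cylmap (v t, pv t)) \<subseteq> nu_level d m1 m2 h g"
      using newton_solution_energy[OF sol Vnu_deriv, of _ 0] init z'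
      by (auto intro!: nu_levelI)
    show "Cv \<inter> range (\<lambda>t. cylmap (v t, pv t)) \<noteq> {}" using z init by blast
  qed
  then show thesis using that sol by blast
qed

lemma nu_contractible_if_barrier:
  assumes sub: "Cv \<subseteq> nu_level d m1 m2 h g" and s: "\<bar>s\<bar> \<le> 1" "Vnu s > g"
  shows "nu_contractible Cv"
proof -
  define \<theta> where "\<theta> = arcsin s + pi"
  define w where "w = (\<lambda>z::real \<times> real \<times> real. Complex (fst z) (fst (snd z)) * cis (- \<theta>))"
  define \<sigma> where "\<sigma> = (\<lambda>z::real \<times> real \<times> real. (\<theta> + Im (Ln (w z)), snd (snd z)))"
  have w: "w z \<notin> \<real>\<^sub>\<le>\<^sub>0 \<and> cylmap (\<sigma> z) = z" if "z \<in> Cv" for z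
  proof -
    have "z \<in> nu_level d m1 m2 h g" using that sub by blast
    then obtain y where y: "z = cylmap y" by (auto simp: nu_level_def)
    then have "Vnu (sin (fst y)) \<le> g"
      using nu_levelD[of y g] that sub zero_le_power2[of "snd y"] by force
    then have ne: "sin (fst y) \<noteq> s" using s(2) by auto
    have "Complex (cos (fst y)) (sin (fst y)) = cis (fst y)" by (simp add: cis.code)
    then have wz: "w z = cis (fst y - \<theta>)"
      by (simp add: w_def y cylmap_def cis_mult)
    have 1: "w z \<notin> \<real>\<^sub>\<le>\<^sub>0"
    proof
      assume "w z \<in> \<real>\<^sub>\<le>\<^sub>0"
      then obtain r where r: "w z = of_real r" "r \<le> 0" by (auto elim: nonpos_Reals_cases)
      then have "norm (w z) = - r" by simp
      then have "r = -1" by (simp add: wz)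
      then have "cis (fst y - \<theta>) = cis pi" using r wz by simp
      then have "cis (fst y - \<theta>) * cis \<theta> = cis pi * cis \<theta>" by simp
      then have "cis (fst y) = cis (pi + \<theta>)"
        by (simp only: cis_mult diff_add_cancel)
      then have "sin (fst y) = sin (pi + \<theta>)" by (metis cis.sel(2))
      then show False using ne s(1) by (simp add: \<theta>_def sin_add abs_le_iff)
    qed
    have "cis (Im (Ln (w z))) = w z"
    proof -
      have "exp (Ln (w z)) = w z" by (rule exp_Ln) (simp add: wz)
      moreover have "Re (Ln (w z)) = 0" by (subst Re_Ln) (simp_all add: wz)
      ultimately show ?thesis by (metis exp_eq_polar mult_1 of_real_1 exp_zero)
    qed
    then have "cis (\<theta> + Im (Ln (w z))) = cis (fst y)"
      by (simp add: wz cis_mult flip: cis_mult[of \<theta>])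
    then have "cos (\<theta> + Im (Ln (w z))) = cos (fst y)" "sin (\<theta> + Im (Ln (w z))) = sin (fst y)"
      by (metis cis.sel(1), metis cis.sel(2))
    then show ?thesis using 1 by (simp add: \<sigma>_def y cylmap_def)
  qed
  have "continuous_on Cv \<sigma>"
  proof -
    have "continuous_on Cv w"
      unfolding w_def by (intro continuous_intros)
    then show ?thesis
      unfolding \<sigma>_def using w by (intro continuous_intros) auto
  qed
  then obtain c where "homotopic_with_canon (\<lambda>_. True) Cv cylinder (cylmap \<circ> \<sigma>) (\<lambda>_. c)"
    using nullhomotopic_through_contractible[of Cv \<sigma> UNIV cylmap cylinder] continuous_on_cylmap
      contractible_UNIV by (auto simp: cylinder_def)
  then have "homotopic_with_canon (\<lambda>_. True) Cv cylinder id (\<lambda>_. c)"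
    by (rule homotopic_with_eq) (use w in auto)
  then show ?thesis unfolding nu_contractible_def by blast
qed

lemma nu_not_contractible_if_rotation:
  assumes comp: "Cv \<in> components (nu_level d m1 m2 h g)" and V: "\<And>s. \<bar>s\<bar> \<le> 1 \<Longrightarrow> Vnu s < g"
  shows "\<not> nu_contractible Cv"
proof
  assume "nu_contractible Cv"
  then obtain c where hom: "homotopic_with_canon (\<lambda>_. True) Cv cylinder id (\<lambda>_. c)"
    unfolding nu_contractible_def by blast
  obtain z where z: "z \<in> Cv" using in_components_nonempty[OF comp] by blast
  then have "z \<in> nu_level d m1 m2 h g" using in_components_subset[OF comp] by blast
  then obtain y where y: "z = cylmap y" by (auto simp: nu_level_def)
  then have yg: "(snd y)\<^sup>2 / 2 + Vnu (sin (fst y)) = g"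
    using nu_levelD \<open>z \<in> nu_level d m1 m2 h g\<close> by blast
  define e where "e = (if snd y \<ge> 0 then 1 else - 1 :: real)"
  define \<phi> where "\<phi> = (\<lambda>u::complex. (Re u, Im u, e * sqrt (2 * (g - Vnu (Im u)))))"
  have cont: "continuous_on A \<phi>" for A
    unfolding \<phi>_def Vnu_def by (intro continuous_intros)
  have image: "\<phi> ` sphere 0 1 \<subseteq> Cv"
  proof (rule components_maximal[OF comp])
    show "connected (\<phi> ` sphere 0 1)"
      by (intro connected_continuous_image cont connected_sphere) simp
    show "\<phi> ` sphere 0 1 \<subseteq> nu_level d m1 m2 h g"
    proof
      fix q assume "q \<in> \<phi> ` sphere 0 1"
      then obtain u where u: "norm u = 1" "q = \<phi> u" by auto
      define x where "x = Arg u"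
      have "u = cis x" using rcis_cmod_Arg[of u] u(1) by (simp add: rcis_def x_def)
      then have q: "q = cylmap (x, e * sqrt (2 * (g - Vnu (sin x))))"
        by (simp add: u(2) \<phi>_def cylmap_def)
      have "Vnu (sin x) < g" by (rule V) simp
      then have "(e * sqrt (2 * (g - Vnu (sin x))))\<^sup>2 = 2 * (g - Vnu (sin x))"
        by (simp add: power_mult_distrib e_def)
      then show "q \<in> nu_level d m1 m2 h g"
        unfolding q by (intro nu_levelI) (simp add: field_simps)
    qed
    have "2 * (g - Vnu (sin (fst y))) = (snd y)\<^sup>2" using yg by simp
    then have "\<phi> (cis (fst y)) = z" by (simp add: \<phi>_def y cylmap_def e_def)
    then have "z \<in> \<phi> ` sphere 0 1" by (intro image_eqI[of _ _ "cis (fst y)"]) auto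
    then show "Cv \<inter> \<phi> ` sphere 0 1 \<noteq> {}" using z by blast
  qed
  define \<pi> where "\<pi> = (\<lambda>z::real \<times> real \<times> real. Complex (fst z) (fst (snd z)))"
  have "homotopic_with_canon (\<lambda>_. True) (sphere 0 1) cylinder (id \<circ> \<phi>) ((\<lambda>_. c) \<circ> \<phi>)"
    by (rule homotopic_with_compose_continuous_right[OF hom cont]) (use image in blast)
  then have "homotopic_with_canon (\<lambda>_. True) (sphere 0 1) (sphere 0 1)
      (\<pi> \<circ> (id \<circ> \<phi>)) (\<pi> \<circ> ((\<lambda>_. c) \<circ> \<phi>))"
  proof (rule homotopic_with_compose_continuous_left)
    show "continuous_on cylinder \<pi>" unfolding \<pi>_def by (intro continuous_intros)
    show "\<pi> \<in> cylinder \<rightarrow> sphere 0 1"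
      by (auto simp: \<pi>_def cylinder_def cylmap_def cmod_def)
  qed
  then have "homotopic_with_canon (\<lambda>_. True) (sphere 0 1) (sphere 0 1) id (\<lambda>_. \<pi> c)"
    by (rule homotopic_with_eq) (auto simp: \<pi>_def \<phi>_def)
  then have "contractible (sphere (0::complex) 1)" unfolding contractible_def by blast
  then show False by (simp add: contractible_sphere)
qed

lemma nu_level_dichotomy:
  assumes reg: "regular_value (Hnu d m1 m2 h) g"
  shows "(\<exists>s. \<bar>s\<bar> \<le> 1 \<and> Vnu s > g) \<or> (\<forall>s. \<bar>s\<bar> \<le> 1 \<longrightarrow> Vnu s < g)"
proof (rule ccontr)
  assume "\<not> ?thesis"
  then obtain s where s: "\<bar>s\<bar> \<le> 1" "Vnu s = g" and le: "\<And>s. \<bar>s\<bar> \<le> 1 \<Longrightarrow> Vnu s \<le> g"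
    by (meson not_le order_antisym)
  have x: "sin (arcsin s) = s" using s(1) by (simp add: abs_le_iff)
  have "- Fnu (arcsin s) = 0"
    by (rule DERIV_local_max[OF Vnu_deriv zero_less_one]) (use le s x in auto)
  then show False using nu_regular[OF reg, of "arcsin s"] x s by simp
qed

lemma Ulam_1_ne:
  assumes "regular_value (Hlam d m1 m2 h) (- g)"
  shows "Ulam 1 \<noteq> - g"
  using lam_regular[OF assms, of 0] by (auto simp: Flam_def)

lemma Ulam_1_less_if_barrier:
  assumes reg: "regular_value (Hlam d m1 m2 h) (- g)" and s: "\<bar>s\<bar> \<le> 1" "Vnu s > g"
    and level: "p\<^sup>2 / 2 + Ulam (cosh x) = - g"
  shows "Ulam 1 < - g"
proof -
  define \<alpha> \<beta> where "\<alpha> = - (h * d\<^sup>2)" and "\<beta> = d * (m1 + m2)"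
  have ab: "\<alpha> > 0" "\<beta> > 0" using hd2_neg pos by (auto simp: \<alpha>_def \<beta>_def)
  show ?thesis
  proof (cases "\<beta> \<le> 2 * \<alpha>")
    case True
    define c where "c = cosh x"
    have c: "c \<ge> 1" unfolding c_def by (rule cosh_real_ge_1)
    have "\<beta> \<le> \<alpha> * 2" using True by simp
    also have "\<dots> \<le> \<alpha> * (c + 1)" using c ab by (intro mult_left_mono) auto
    finally have "\<beta> \<le> \<alpha> * (c + 1)" .
    then have "0 \<le> (c - 1) * (\<alpha> * (c + 1) - \<beta>)" using c by simp
    also have "\<dots> = Ulam c - Ulam 1"
      by (simp add: Ulam_def \<alpha>_def \<beta>_def power2_eq_square algebra_simps)
    finally have "Ulam 1 \<le> - g" using level zero_le_power2[of p] unfolding c_def by linarith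
    then show ?thesis using Ulam_1_ne[OF reg] by simp
  next
    case False
    define t where "t = \<bar>s\<bar>"
    have t: "0 \<le> t" "t \<le> 1" using s(1) by (auto simp: t_def)
    have "d * (m1 - m2) * s \<le> \<beta> * t"
    proof -
      have "d * (m1 - m2) * s \<le> \<bar>d * (m1 - m2)\<bar> * t"
        unfolding t_def abs_mult[symmetric] by (rule abs_ge_self)
      also have "\<dots> \<le> \<beta> * t"
        using pos t unfolding \<beta>_def by (intro mult_right_mono) (auto simp: abs_mult)
      finally show ?thesis .
    qed
    then have "Vnu s \<le> \<beta> * t - \<alpha> * t\<^sup>2" by (simp add: Vnu_def \<alpha>_def t_def)
    moreover have "\<beta> * t - \<alpha> * t\<^sup>2 \<le> \<beta> - \<alpha>"
    proof -
      have "\<alpha> * (1 + t) \<le> \<alpha> * 2" using t ab by (intro mult_left_mono) auto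
      then have "0 \<le> (1 - t) * (\<beta> - \<alpha> * (1 + t))" using t False by simp
      then show ?thesis by (simp add: power2_eq_square algebra_simps)
    qed
    moreover have "- Ulam 1 = \<beta> - \<alpha>" by (simp add: Ulam_def \<alpha>_def \<beta>_def)
    ultimately show ?thesis using s(2) by linarith
  qed
qed

lemma torus_orbit_iff:
  "torus_orbit d m1 m2 h Cl Cv l pl v pv \<longleftrightarrow> newton_solution Flam l pl \<and> newton_solution Fnu v pv \<and>
     (\<forall>t. (l t, pl t) \<in> Cl \<and> cylmap (v t, pv t) \<in> Cv)"
  by (simp add: torus_orbit_def lam_solution_iff nu_solution_iff)

lemma prescribed_intercept_realized:
  fixes A S a c :: real
  assumes orbit: "torus_orbit d m1 m2 h Cl Cv l pl v pv" and "A > 0" "S > 0"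
    and l: "{t. l t = 0} = range (\<lambda>k::int. a + of_int k * A)"
    and v: "{t. cos (v t) = 0} = range (\<lambda>k::int. c + of_int k * S)"
    and W: "W = S / A" and avoid: "line_avoids_lattice W y0"
    and b: "\<And>i::int. b i = (if sin (v (c + of_int i * S)) < 0 then 1 else 2)"
  shows "\<exists>l pl v pv s. torus_orbit d m1 m2 h Cl Cv l pl v pv \<and> non_collision l v \<and>
    syzygy_seq l v s \<and> block_form b (sturmian W y0) s"
proof -
  define e where "e = c - A * (y0 - W)"
  have orbit': "torus_orbit d m1 m2 h Cl Cv (\<lambda>t. l (t + a)) (\<lambda>t. pl (t + a)) (\<lambda>t. v (t + e)) (\<lambda>t. pv (t + e))"
    using orbit by (simp add: torus_orbit_iff newton_solution_time_shift)
  have y0: "y0 = ((c - e) - (a - a)) / A + W" using \<open>A > 0\<close> by (simp add: e_def)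
  have b': "b i = (if sin (v (c - e + of_int i * S + e)) < 0 then 1 else 2)" for i
    unfolding b by (simp add: algebra_simps)
  have "non_collision (\<lambda>t. l (t + a)) (\<lambda>t. v (t + e)) \<and>
    (\<exists>s. syzygy_seq (\<lambda>t. l (t + a)) (\<lambda>t. v (t + e)) s \<and> block_form b (sturmian W y0) s)"
    by (rule syzygy_seq_block_form[OF \<open>A > 0\<close> \<open>S > 0\<close> shift_zero_times[OF l] shift_zero_times[OF v]
          W y0 avoid b'])
  with orbit' show ?thesis by blast
qed

end

theorem theorem2:
  fixes d m1 m2 h g W :: real
    and Cl :: "(real \<times> real) set" and Cv :: "(real \<times> real \<times> real) set"
  assumes "d > 0" and "m1 > 0" and "m2 > 0" and "h < 0"
    and torus: "regular_torus d m1 m2 h g Cl Cv"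
    and rot: "rotation_number d m1 m2 h Cl Cv W"
  shows
    "(\<forall>l pl v pv.
        torus_orbit d m1 m2 h Cl Cv l pl v pv \<and> non_collision l v \<longrightarrow>
          (type_P Cl Cv \<longrightarrow> (\<exists>s. syzygy_seq l v s \<and> pattern_P s)) \<and>
          (type_L Cl Cv \<longrightarrow> (\<exists>s y0. syzygy_seq l v s \<and> line_avoids_lattice W y0 \<and>
             pattern_L (sturmian W y0) s)) \<and>
          (type_S Cl Cv \<longrightarrow> (\<exists>s y0. syzygy_seq l v s \<and> line_avoids_lattice W y0 \<and>
             pattern_S (sturmian W y0) s)))
     \<and> (type_L Cl Cv \<longrightarrow> (\<forall>y0. line_avoids_lattice W y0 \<longrightarrow>
          (\<exists>l pl v pv s. torus_orbit d m1 m2 h Cl Cv l pl v pv \<and> non_collision l v \<and>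
             syzygy_seq l v s \<and> pattern_L (sturmian W y0) s)))
     \<and> (type_S Cl Cv \<longrightarrow> (\<forall>y0. line_avoids_lattice W y0 \<longrightarrow>
          (\<exists>l pl v pv s. torus_orbit d m1 m2 h Cl Cv l pl v pv \<and> non_collision l v \<and>
             syzygy_seq l v s \<and> pattern_S (sturmian W y0) s)))"
proof -
  interpret two_center d m1 m2 h by unfold_locales fact+
  have reg: "regular_value (Hlam d m1 m2 h) (- g)" "regular_value (Hnu d m1 m2 h) g"
    and comp: "Cl \<in> components (lam_level d m1 m2 h g)" "Cv \<in> components (nu_level d m1 m2 h g)"
    using torus unfolding regular_torus_def by auto
  obtain Tl Tv where per: "lam_period d m1 m2 h Cl Tl" "nu_period d m1 m2 h Cv Tv" and W: "W = Tv / Tl"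
    using rot unfolding rotation_number_def by blast
  let ?orbit = "torus_orbit d m1 m2 h Cl Cv"

  obtain x0 p0 where z0: "(x0, p0) \<in> Cl" using in_components_nonempty[OF comp(1)] by auto
  have level0: "p0\<^sup>2 / 2 + Ulam (cosh x0) = - g"
    using in_components_subset[OF comp(1)] z0 by (auto simp: lam_level_def Hlam_eq)
  obtain l0 pl0 where l0: "newton_solution Flam l0 pl0" "\<And>t. (l0 t, pl0 t) \<in> Cl"
    using lam_level_orbit[OF comp(1) z0] by metis
  obtain y where y: "cylmap y \<in> Cv"
    using in_components_nonempty[OF comp(2)] in_components_subset[OF comp(2)]
    unfolding nu_level_def by blast
  then obtain v0 pv0 where v0: "newton_solution Fnu v0 pv0" "\<And>t. cylmap (v0 t, pv0 t) \<in> Cv"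
    using nu_level_orbit[OF comp(2), of "fst y" "snd y"] by (metis prod.collapse)
  have orbit0: "?orbit l0 pl0 v0 pv0" using l0 v0 by (simp add: torus_orbit_iff)

  have minper: "min_period (\<lambda>t. (l t, pl t)) Tl" "min_period (\<lambda>t. cylmap (v t, pv t)) Tv"
    if "?orbit l pl v pv" for l pl v pv
    using that per unfolding lam_period_def nu_period_def torus_orbit_def by blast+
  have T: "Tl / 2 > 0" "Tv / 2 > 0"
    using minper[OF orbit0] by (auto simp: min_period_def)
  have W': "W = (Tv / 2) / (Tl / 2)" by (simp add: W)
  have level: "(pl t)\<^sup>2 / 2 + Ulam (cosh (l t)) = - g" "(pv t)\<^sup>2 / 2 + Vnu (sin (v t)) = g"
    if "?orbit l pl v pv" for l pl v pv t
  proof -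
    have "(l t, pl t) \<in> Cl" "cylmap (v t, pv t) \<in> Cv" using that by (auto simp: torus_orbit_iff)
    then show "(pl t)\<^sup>2 / 2 + Ulam (cosh (l t)) = - g" "(pv t)\<^sup>2 / 2 + Vnu (sin (v t)) = g"
      using in_components_subset[OF comp(1)] in_components_subset[OF comp(2)] nu_levelD[of "(v t, pv t)" g]
      by (auto simp: lam_level_def Hlam_eq)
  qed

  have rotation: "Vnu s < g" if "\<not> nu_contractible Cv" "\<bar>s\<bar> \<le> 1" for s
    using nu_level_dichotomy[OF reg(2)] nu_contractible_if_barrier[OF in_components_subset[OF comp(2)]] that
    by blast
  have barrier: "\<exists>s. \<bar>s\<bar> \<le> 1 \<and> Vnu s > g" if "nu_contractible Cv"
    using nu_level_dichotomy[OF reg(2)] nu_not_contractible_if_rotation[OF comp(2)] that by blast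
  have U1: "Ulam 1 < - g" if "type_L Cl Cv \<or> type_S Cl Cv"
    using that
  proof
    assume "type_L Cl Cv"
    then obtain p where "(0, p) \<in> Cl" unfolding type_L_def by blast
    then have "p\<^sup>2 / 2 + Ulam 1 = - g"
      using in_components_subset[OF comp(1)] by (auto simp: lam_level_def Hlam_eq)
    then have "Ulam 1 \<le> - g" using zero_le_power2[of p] by linarith
    then show ?thesis using Ulam_1_ne[OF reg(1)] by simp
  next
    assume "type_S Cl Cv"
    then obtain s where "\<bar>s\<bar> \<le> 1" "Vnu s > g" using barrier unfolding type_S_def by blast
    then show ?thesis by (rule Ulam_1_less_if_barrier[OF reg(1) _ _ level0])
  qed

  have lam_zeros: "\<exists>a. {t. l t = 0} = range (\<lambda>k::int. a + of_int k * (Tl / 2))"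
    if orbit: "?orbit l pl v pv" and LS: "type_L Cl Cv \<or> type_S Cl Cv" for l pl v pv
  proof -
    have "newton_solution Flam l pl" using orbit by (simp add: torus_orbit_iff)
    then obtain a where "{t. l t = 0} = range (\<lambda>k::int. a + of_int k * (Tl / 2))"
      by (rule lam_zero_times[OF _ level(1)[OF orbit] reg(1) U1[OF LS] minper(1)[OF orbit]])
    then show ?thesis by (rule exI)
  qed
  have nu_rotation: "\<exists>b. {t. cos (v t) = 0} = range (\<lambda>k::int. b + of_int k * (Tv / 2)) \<and>
      (\<forall>k::int. sin (v (b + of_int k * (Tv / 2))) = (if even k then 1 else -1))"
    if orbit: "?orbit l pl v pv" and nc: "\<not> nu_contractible Cv" for l pl v pv
  proof -
    have "newton_solution Fnu v pv" using orbit by (simp add: torus_orbit_iff)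
    then obtain b where "{t. cos (v t) = 0} = range (\<lambda>k::int. b + of_int k * (Tv / 2))"
      "\<And>k::int. sin (v (b + of_int k * (Tv / 2))) = (if even k then 1 else -1)"
      by (rule nu_rotation_zero_times[OF _ level(2)[OF orbit] rotation[OF nc] minper(2)[OF orbit]])
        (assumption | rule that)+
    then show ?thesis by (intro exI conjI allI)
  qed
  have nu_oscillation: "\<exists>b c. {t. cos (v t) = 0} = range (\<lambda>k::int. b + of_int k * (Tv / 2)) \<and>
      (\<forall>k::int. v (b + of_int k * (Tv / 2)) = c)"
    if orbit: "?orbit l pl v pv" and S: "type_S Cl Cv" for l pl v pv
  proof -
    obtain s where s: "\<bar>s\<bar> \<le> 1" "Vnu s > g" using barrier S unfolding type_S_def by blast
    have "newton_solution Fnu v pv" using orbit by (simp add: torus_orbit_iff)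
    then obtain b c where b: "{t. cos (v t) = 0} = range (\<lambda>k::int. b + of_int k * (Tv / 2))"
      and c: "\<And>t. cos (v t) = 0 \<Longrightarrow> v t = c"
      by (rule nu_oscillation_zero_times[OF _ level(2)[OF orbit] reg(2) s minper(2)[OF orbit]]) (rule that)
    have "v (b + of_int k * (Tv / 2)) = c" for k :: int
      by (rule c) (use b in blast)
    with b show ?thesis by (intro exI conjI allI)
  qed

  have letters_L: "(if odd i then 1 else 2 :: nat) = (if (if even i then 1 else -1 :: real) < 0 then 1 else 2)"
    for i :: int by simp
  have letters_S: "pattern_S n s" if "block_form (\<lambda>i. if sin c < 0 then 1 else 2) n s" for n s c
    using that unfolding pattern_S_def by (cases "sin c < 0") auto

  show ?thesis
  proof (intro conjI allI impI, goal_cases)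
    case (1 l pl v pv)
    then have orbit: "?orbit l pl v pv" and P: "\<not> nu_contractible Cv" "\<And>p. (0, p) \<notin> Cl"
      by (auto simp: type_P_def)
    from nu_rotation[OF orbit P(1)] obtain b where
      "{t. cos (v t) = 0} = range (\<lambda>k::int. b + of_int k * (Tv / 2))"
      "\<And>k::int. sin (v (b + of_int k * (Tv / 2))) = (if even k then 1 else -1)" by blast
    moreover have "l t \<noteq> 0" for t
      using orbit P(2)[of "pl t"] by (metis torus_orbit_iff)
    ultimately show ?case using syzygy_seq_rotation_only[OF T(2)] by blast
  next
    case (2 l pl v pv)
    then have orbit: "?orbit l pl v pv" and nc: "non_collision l v" and L: "\<not> nu_contractible Cv"
      by (auto simp: type_L_def)
    obtain a where a: "{t. l t = 0} = range (\<lambda>k::int. a + of_int k * (Tl / 2))"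
      using lam_zeros[OF orbit] 2 by blast
    from nu_rotation[OF orbit L] obtain b where
      b: "{t. cos (v t) = 0} = range (\<lambda>k::int. b + of_int k * (Tv / 2))"
      "\<And>k::int. sin (v (b + of_int k * (Tv / 2))) = (if even k then 1 else -1)" by blast
    show ?case unfolding pattern_L_def
      by (rule syzygy_seq_block_form_non_collision[OF T a b(1) W' nc]) (unfold b(2), rule letters_L)
  next
    case (3 l pl v pv)
    then have orbit: "?orbit l pl v pv" and nc: "non_collision l v" by auto
    obtain a where a: "{t. l t = 0} = range (\<lambda>k::int. a + of_int k * (Tl / 2))"
      using lam_zeros[OF orbit] 3 by blast
    from nu_oscillation[OF orbit] 3 obtain b c where
      b: "{t. cos (v t) = 0} = range (\<lambda>k::int. b + of_int k * (Tv / 2))"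
      "\<And>k::int. v (b + of_int k * (Tv / 2)) = c" by blast
    have "\<exists>s y0. syzygy_seq l v s \<and> line_avoids_lattice W y0 \<and>
        block_form (\<lambda>i. if sin c < 0 then 1 else 2) (sturmian W y0) s"
      by (rule syzygy_seq_block_form_non_collision[OF T a b(1) W' nc]) (simp only: b(2))
    then show ?case using letters_S by blast
  next
    case (4 y0)
    then have L: "\<not> nu_contractible Cv" by (simp add: type_L_def)
    obtain a where a: "{t. l0 t = 0} = range (\<lambda>k::int. a + of_int k * (Tl / 2))"
      using lam_zeros[OF orbit0] 4 by blast
    from nu_rotation[OF orbit0 L] obtain b where
      b: "{t. cos (v0 t) = 0} = range (\<lambda>k::int. b + of_int k * (Tv / 2))"
      "\<And>k::int. sin (v0 (b + of_int k * (Tv / 2))) = (if even k then 1 else -1)" by blast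
    show ?case unfolding pattern_L_def
      by (rule prescribed_intercept_realized[OF orbit0 T a b(1) W' 4(2)]) (unfold b(2), rule letters_L)
  next
    case (5 y0)
    obtain a where a: "{t. l0 t = 0} = range (\<lambda>k::int. a + of_int k * (Tl / 2))"
      using lam_zeros[OF orbit0] 5 by blast
    from nu_oscillation[OF orbit0] 5 obtain b c where
      b: "{t. cos (v0 t) = 0} = range (\<lambda>k::int. b + of_int k * (Tv / 2))"
      "\<And>k::int. v0 (b + of_int k * (Tv / 2)) = c" by blast
    have "\<exists>l pl v pv s. ?orbit l pl v pv \<and> non_collision l v \<and> syzygy_seq l v s \<and>
        block_form (\<lambda>i. if sin c < 0 then 1 else 2) (sturmian W y0) s"
      by (rule prescribed_intercept_realized[OF orbit0 T a b(1) W' 5(2)]) (simp only: b(2))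
    then show ?case using letters_S by blast
  qed
qed

end
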